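(* Let $(M,d,0_M)$ and $(N,d,0_N)$ be complete pointed metric spaces and let $f\colon M\to N$ be a Lipschitz map with $f(0_M)=0_N$. Then the operator $\widehat f\colon\mathcal F(M)\to\mathcal F(N)$ is compact if and only if the following three conditions hold: $(P_1)$ for every bounded subset $S\subset M$, $f(S)$ is totally bounded in $N$; $(P_2)$ $f$ is uniformly locally flat, i.e. $\displaystyle\lim_{d(x,y)\to0}\frac{d(f(x),f(y))}{d(x,y)}=0$ (for every $\varepsilon>0$ there is $\delta>0$ such that $d(f(x),f(y))\le\varepsilon d(x,y)$ whenever $0<d(x,y)\le\delta$); $(P_3)$ for every sequence $(x_n,y_n)_n$ in $\widetilde M:=\{(x,y)\in M\times M: x\neq y\}$ such that $\lim_n d(x_n,0_M)=\lim_n d(y_n,0_M)=\infty$, either $(f(x_n),f(y_n))_n$ has an accumulation point in $N\times N$, or $\displaystyle\liminf_{n\to\infty}\frac{d(f(x_n),f(y_n))}{d(x_n,y_n)}=0$.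
   Context: Scalars are $\mathbb K=\mathbb R$ or $\mathbb C$. For a pointed metric space $(M,d,0_M)$, $\mathrm{Lip}_0(M)$ denotes the Banach space of Lipschitz functions $g\colon M\to\mathbb K$ with $g(0_M)=0$, normed by the best Lipschitz constant $\mathrm{Lip}(g)=\sup_{x\neq y}|g(x)-g(y)|/d(x,y)$. For $x\in M$, $\delta(x)\in\mathrm{Lip}_0(M)^*$ is the evaluation functional $\langle g,\delta(x)\rangle=g(x)$. The Lipschitz-free space $\mathcal F(M)$ is the norm-closed linear span of $\{\delta(x):x\in M\}$ in $\mathrm{Lip}_0(M)^*$; its dual is isometrically $\mathrm{Lip}_0(M)$. For a Lipschitz map $f\colon M\to N$ with $f(0_M)=0_N$, $\widehat f\colon\mathcal F(M)\to\mathcal F(N)$ is the unique bounded linear operator with $\widehat f(\delta(x))=\delta(f(x))$ for all $x\in M$ (so $\widehat f(\sum a_i\delta(x_i))=\sum a_i\delta(f(x_i))$ and $\|\widehat f\|=\mathrm{Lip}(f)$). *)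

theory Defs
  imports "HOL-Analysis.Analysis" "HOL-Library.Liminf_Limsup"
begin

definition lip0 :: "'a::metric_space \<Rightarrow> ('a \<Rightarrow> 'k::real_normed_field) set" where
  "lip0 z = {g. g z = 0 \<and> (\<exists>C. \<forall>x y. norm (g x - g y) \<le> C * dist x y)}"

definition lip0_ball :: "'a::metric_space \<Rightarrow> ('a \<Rightarrow> 'k::real_normed_field) set" where
  "lip0_ball z = {g \<in> lip0 z. \<forall>x y. norm (g x - g y) \<le> dist x y}"

text \<open>The dual Lip_0(M)^*: bounded linear functionals on Lip_0(M)
  (normalised to vanish outside Lip_0(M), so that equality is extensional).\<close>
definition lip0_dual :: "'a::metric_space \<Rightarrow> (('a \<Rightarrow> 'k::real_normed_field) \<Rightarrow> 'k) set" where
  "lip0_dual z = {\<Phi>.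
     (\<forall>g h. g \<in> lip0 z \<longrightarrow> h \<in> lip0 z \<longrightarrow> \<Phi> (\<lambda>x. g x + h x) = \<Phi> g + \<Phi> h) \<and>
     (\<forall>c g. g \<in> lip0 z \<longrightarrow> \<Phi> (\<lambda>x. c * g x) = c * \<Phi> g) \<and>
     (\<exists>C. \<forall>g \<in> lip0_ball z. norm (\<Phi> g) \<le> C) \<and>
     (\<forall>g. g \<notin> lip0 z \<longrightarrow> \<Phi> g = 0)}"

definition dual_norm :: "'a::metric_space \<Rightarrow> (('a \<Rightarrow> 'k::real_normed_field) \<Rightarrow> 'k) \<Rightarrow> real" where
  "dual_norm z \<Phi> = (SUP g \<in> lip0_ball z. norm (\<Phi> g))"

definition evalf :: "'a::metric_space \<Rightarrow> 'a \<Rightarrow> ('a \<Rightarrow> 'k::real_normed_field) \<Rightarrow> 'k" where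
  "evalf z x = (\<lambda>g. if g \<in> lip0 z then g x else 0)"

definition free_space :: "'a::metric_space \<Rightarrow> (('a \<Rightarrow> 'k::real_normed_field) \<Rightarrow> 'k) set" where
  "free_space z = {\<Phi> \<in> lip0_dual z. \<forall>\<epsilon>>0. \<exists>P a. finite P \<and>
      dual_norm z (\<lambda>g. \<Phi> g - (\<Sum>p\<in>P. a p * evalf z p g)) < \<epsilon>}"

text \<open>The linearisation hat f: F(M) -> F(N), given by (hat f Phi)(g) = Phi(g o f) for g in Lip_0(N);
  on F(M) this is the unique bounded linear operator with hat f (delta x) = delta (f x).\<close>
definition free_lift :: "'b::metric_space \<Rightarrow> ('a \<Rightarrow> 'b) \<Rightarrow> (('a \<Rightarrow> 'k::real_normed_field) \<Rightarrow> 'k)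
    \<Rightarrow> ('b \<Rightarrow> 'k) \<Rightarrow> 'k" where
  "free_lift zN f \<Phi> = (\<lambda>g. if g \<in> lip0 zN then \<Phi> (g \<circ> f) else 0)"

definition free_lift_compact :: "'k::real_normed_field itself \<Rightarrow> 'a::metric_space \<Rightarrow> 'b::metric_space
    \<Rightarrow> ('a \<Rightarrow> 'b) \<Rightarrow> bool" where
  "free_lift_compact _ zM zN f \<longleftrightarrow>
    (\<forall>s :: nat \<Rightarrow> ('a \<Rightarrow> 'k) \<Rightarrow> 'k.
       (\<forall>n. s n \<in> free_space zM \<and> dual_norm zM (s n) \<le> 1) \<longrightarrow>
       (\<exists>r \<Psi>. strict_mono r \<and> \<Psi> \<in> free_space zN \<and>
          (\<lambda>n. dual_norm zN (\<lambda>g. free_lift zN f (s (r n)) g - \<Psi> g)) \<longlonglongrightarrow> 0))"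

end

theory Submission
  imports Defs "HOL-Complex_Analysis.Great_Picard"
begin

text \<open>Write \<open>m(x, y) = (\<delta>(x) - \<delta>(y)) / d(x, y)\<close> for the molecules, so that the operator sends
  \<open>m(x, y)\<close> to \<open>(\<delta>(f x) - \<delta>(f y)) / d(x, y)\<close>.

  If the operator is compact, take molecules whose images converge and do not become small. Their
  limit is almost finitely supported, and bump functions vanishing on the support show that \<open>f x\<close>
  and \<open>f y\<close> are both close to it relative to \<open>d(f x, f y)\<close>. Hence, along a subsequence, the pairs
  \<open>(f x, f y)\<close> converge to a pair of distinct points. All three metric conditions follow from this.

  Conversely, the three conditions give every sequence of pairs a subsequence along which the images
  of the molecules converge uniformly on the unit ball of \<open>Lip\<^sub>0(N)\<close>, so these images are totally
  bounded. As in the Arzela-Ascoli theorem, the set of all \<open>g \<circ> f\<close> with \<open>g\<close> in that ball is then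
  totally bounded in \<open>Lip\<^sub>0(M)\<close>. As in Schauder's theorem, a diagonal subsequence of functionals that
  converges on a countable dense set of such compositions converges uniformly on all of them. This
  argument works on the dual side, so neither Hahn-Banach nor a description of the unit ball of the
  free space is needed.\<close>

section \<open>Sequences\<close>

text \<open>Greedy choice: as long as no finite subset of \<open>A\<close> is a net, some point of
  \<open>A\<close> is \<open>R\<close>-separated from all points chosen so far. \<open>R\<close> is
  an arbitrary relation because the dichotomy is applied to points, to pairs of points and to
  functions.\<close>

lemma finite_net_or_separated_sequence:
  assumes "\<not> (\<exists>T. finite T \<and> T \<subseteq> A \<and> (\<forall>x\<in>A. \<exists>t\<in>T. \<not> R t x))"
  obtains s :: "nat \<Rightarrow> 'a" where "\<And>n. s n \<in> A" "\<And>m n. m < n \<Longrightarrow> R (s m) (s n)"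
proof -
  have "\<exists>s. \<forall>n::nat. s n \<in> A \<and> (\<forall>m<n. R (s m) (s n))"
  proof (rule dependent_wellorder_choice)
    fix n :: nat and s
    assume "\<And>y. y < n \<Longrightarrow> s y \<in> A \<and> (\<forall>m<y. R (s m) (s y))"
    then have "finite (s ` {..<n})" "s ` {..<n} \<subseteq> A" by auto
    then have "\<not> (\<forall>x\<in>A. \<exists>t\<in>s ` {..<n}. \<not> R t x)"
      using assms[unfolded not_ex, THEN spec, of "s ` {..<n}"] by simp
    then show "\<exists>x. x \<in> A \<and> (\<forall>m<n. R (s m) x)"
      by auto
  qed simp
  then show thesis using that by blast
qed

lemma frequently_sequentially_subseq:
  assumes "\<exists>\<^sub>F n in sequentially. Q n"
  obtains r :: "nat \<Rightarrow> nat" where "strict_mono r" "\<And>n. Q (r n)"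
proof -
  have "infinite {n. Q n}"
    using assms by (simp add: frequently_cofinite cofinite_eq_sequentially[symmetric])
  then show thesis
    using infinite_enumerate[of "{n. Q n}"] that by auto
qed

text \<open>If \<open>a\<close> does not tend to infinity, infinitely many of its terms lie below a
  common bound, and these form the subsequence.\<close>

lemma bounded_or_unbounded_subseq:
  fixes a :: "nat \<Rightarrow> real"
  obtains (bounded) r B where "strict_mono (r :: nat \<Rightarrow> nat)" "\<And>n. a (r n) \<le> B"
  | (unbounded) "filterlim a at_top sequentially"
proof (cases "filterlim a at_top sequentially")
  case False
  then obtain Z where "\<exists>\<^sub>F n in sequentially. \<not> Z \<le> a n"
    by (auto simp: filterlim_at_top frequently_def)
  then obtain r where "strict_mono (r :: nat \<Rightarrow> nat)" "\<And>n. \<not> Z \<le> a (r n)"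
    using frequently_sequentially_subseq by blast
  then show thesis using bounded[of r Z] by (simp add: less_imp_le not_le)
qed

lemma liminf_ereal_eq_0_subseq:
  fixes a :: "nat \<Rightarrow> real"
  assumes "liminf (\<lambda>n. ereal (a n)) = 0"
  obtains r where "strict_mono r" "(\<lambda>n. a (r n)) \<longlonglongrightarrow> 0"
proof -
  obtain r where r: "strict_mono r" "((\<lambda>n. ereal (a n)) \<circ> r) \<longlonglongrightarrow> liminf (\<lambda>n. ereal (a n))"
    using liminf_subseq_lim by blast
  then have "(\<lambda>n. ereal (a (r n))) \<longlonglongrightarrow> ereal 0"
    using assms by (simp add: o_def zero_ereal_def)
  then show thesis using that r by simp
qed

lemma liminf_ereal_nonneg_neq_0:
  fixes a :: "nat \<Rightarrow> real"
  assumes "\<And>n. 0 \<le> a n" and "liminf (\<lambda>n. ereal (a n)) \<noteq> 0"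
  obtains c where "0 < c" "\<forall>\<^sub>F n in sequentially. c \<le> a n"
proof -
  have "0 \<le> liminf (\<lambda>n. ereal (a n))"
    using assms(1) by (intro Liminf_bounded) simp
  then have "0 < liminf (\<lambda>n. ereal (a n))" using assms(2) by simp
  then obtain c where c: "0 < ereal c" "ereal c < liminf (\<lambda>n. ereal (a n))"
    using ereal_dense2[of 0] by (auto simp: zero_ereal_def)
  then show thesis
    using that[of c] eventually_mono[OF less_LiminfD[OF c(2)], of "\<lambda>n. c \<le> a n"] by auto
qed

text \<open>In a complete space the closure of a totally bounded set is complete and totally
  bounded, hence sequentially compact.\<close>

lemma totally_bounded_convergent_subseq:
  fixes s :: "nat \<Rightarrow> 'a::complete_space"
  assumes "totally_bounded A" "\<And>n. s n \<in> A"
  obtains r l where "strict_mono r" "(\<lambda>n. s (r n)) \<longlonglongrightarrow> l"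
proof -
  have "\<exists>k. finite k \<and> closure A \<subseteq> (\<Union>x\<in>k. ball x e)" if "e > 0" for e
  proof -
    from assms(1) \<open>e > 0\<close> obtain k where k: "finite k" "A \<subseteq> (\<Union>x\<in>k. {y. dist x y < e/2})"
      unfolding totally_bounded_metric by (meson half_gt_zero)
    \<comment> \<open>Finitely many closed balls of radius e/2 form a closed set, so they cover the
      closure as well; doubling the radius returns to open balls.\<close>
    have "closed (\<Union>x\<in>k. cball x (e/2))"
      using k(1) by (intro closed_UN) auto
    moreover have "A \<subseteq> (\<Union>x\<in>k. cball x (e/2))"
      using k(2) by (force simp only: subset_eq UN_iff mem_Collect_eq mem_cball less_imp_le)
    ultimately have "closure A \<subseteq> (\<Union>x\<in>k. cball x (e/2))"
      by (rule closure_minimal[rotated])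
    also have "\<dots> \<subseteq> (\<Union>x\<in>k. ball x e)"
    proof (rule UN_mono)
      show "cball x (e/2) \<subseteq> ball x e" for x :: 'a
        using \<open>e > 0\<close> by (auto simp: subset_eq)
    qed simp
    finally show ?thesis using k(1) by blast
  qed
  then have "compact (closure A)"
    by (simp add: compact_eq_totally_bounded complete_eq_closed)
  moreover have "\<forall>n. s n \<in> closure A"
    using assms(2) closure_subset by blast
  ultimately show thesis
    using that unfolding compact_def o_def by blast
qed

section \<open>The dual norm\<close>

lemma lip0_ball_0: "(\<lambda>x. 0) \<in> lip0_ball z"
  by (auto simp: lip0_ball_def lip0_def intro!: exI[of _ 0])

lemma lip0_ballI:
  assumes "g z = 0" "\<And>x y. norm (g x - g y) \<le> dist x y"
  shows "g \<in> lip0_ball z"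
  using assms by (auto simp: lip0_ball_def lip0_def intro!: exI[of _ 1])

lemma lip0_ballD:
  assumes "g \<in> lip0_ball z"
  shows "g z = 0" "norm (g x - g y) \<le> dist x y" "g \<in> lip0 z"
  using assms by (auto simp: lip0_ball_def lip0_def)

lemma lip0_add:
  assumes "g \<in> lip0 z" "h \<in> lip0 z"
  shows "(\<lambda>x. g x + h x) \<in> lip0 z"
proof -
  obtain C D where *: "\<And>x y. norm (g x - g y) \<le> C * dist x y" "\<And>x y. norm (h x - h y) \<le> D * dist x y"
    using assms unfolding lip0_def by blast
  have "norm (g x + h x - (g y + h y)) \<le> (C + D) * dist x y" for x y
    using order_trans[OF norm_triangle_ineq[of "g x - g y" "h x - h y"] add_mono[OF *]]
    by (simp add: algebra_simps)
  then show ?thesis using assms by (auto simp: lip0_def)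
qed

lemma lip0_mult:
  assumes "g \<in> lip0 z"
  shows "(\<lambda>x. c * g x) \<in> lip0 z"
proof -
  obtain C where *: "\<And>x y. norm (g x - g y) \<le> C * dist x y"
    using assms by (auto simp: lip0_def)
  have "norm (c * g x - c * g y) \<le> (norm c * C) * dist x y" for x y
    using mult_left_mono[OF *, of "norm c"]
    by (simp add: mult.assoc norm_mult flip: right_diff_distrib)
  then show ?thesis using assms by (auto simp: lip0_def)
qed

lemma lip0_normalise:
  fixes q :: "'a::metric_space \<Rightarrow> 'k::real_normed_field"
  assumes "q z = 0" "\<And>x y. norm (q x - q y) \<le> L * dist x y" "L > 0"
  shows "(\<lambda>x. of_real (1 / L) * q x) \<in> lip0_ball z"
proof (rule lip0_ballI)
  fix x y
  have "norm (of_real (1 / L) * q x - of_real (1 / L) * q y) = 1 / L * norm (q x - q y)"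
    using \<open>L > 0\<close> by (simp only: right_diff_distrib[symmetric] norm_mult norm_of_real) simp
  also have "\<dots> \<le> dist x y"
    using assms(2)[of x y] \<open>L > 0\<close> by (simp add: field_simps)
  finally show "norm (of_real (1 / L) * q x - of_real (1 / L) * q y) \<le> dist x y" .
qed (use assms in simp)

lemma lip0_dualD:
  assumes "\<Phi> \<in> lip0_dual z" "g \<in> lip0 z"
  shows "\<Phi> (\<lambda>x. c * g x) = c * \<Phi> g"
    and "h \<in> lip0 z \<Longrightarrow> \<Phi> (\<lambda>x. g x + h x) = \<Phi> g + \<Phi> h"
  using assms unfolding lip0_dual_def by blast+

lemma lip0_compose:
  assumes "C-lipschitz_on UNIV f" "f zM = zN" "g \<in> lip0 zN"
  shows "g \<circ> f \<in> lip0 zM"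
proof -
  obtain D where D: "\<And>x y. norm (g x - g y) \<le> D * dist x y" and "g zN = 0"
    using assms(3) by (auto simp: lip0_def)
  \<comment> \<open>The constant in \<open>lip0\<close> may be negative, as on a one-point space;
    \<open>max D 0\<close> makes multiplication by it monotone.\<close>
  have "norm (g (f x) - g (f y)) \<le> (max D 0 * C) * dist x y" for x y
  proof -
    have "norm (g (f x) - g (f y)) \<le> max D 0 * dist (f x) (f y)"
      by (rule order_trans[OF D]) (auto intro: mult_right_mono)
    also have "\<dots> \<le> max D 0 * (C * dist x y)"
      using lipschitz_onD[OF assms(1)] by (intro mult_left_mono) auto
    finally show ?thesis by (simp add: mult.assoc)
  qed
  then show ?thesis using \<open>g zN = 0\<close> assms(2) by (auto simp: lip0_def)
qed

text \<open>The supremum in \<open>dual_norm\<close> is one of real numbers and is informative only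
  for bounded sets. Boundedness is separated from linearity so that it can be checked directly for
  lifts and for differences with finite sums of evaluations.\<close>

definition ball_bounded :: "'a::metric_space \<Rightarrow> (('a \<Rightarrow> 'k::real_normed_field) \<Rightarrow> 'k) \<Rightarrow> bool" where
  "ball_bounded z \<Phi> \<longleftrightarrow> (\<exists>C. \<forall>g\<in>lip0_ball z. norm (\<Phi> g) \<le> C)"

lemma ball_boundedI: "(\<And>g. g \<in> lip0_ball z \<Longrightarrow> norm (\<Phi> g) \<le> C) \<Longrightarrow> ball_bounded z \<Phi>"
  by (auto simp: ball_bounded_def)

lemma lip0_dual_ball_bounded: "\<Phi> \<in> lip0_dual z \<Longrightarrow> ball_bounded z \<Phi>"
  by (simp add: lip0_dual_def ball_bounded_def)

lemma ball_bounded_diff: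
  assumes "ball_bounded z \<Phi>" "ball_bounded z \<Psi>"
  shows "ball_bounded z (\<lambda>g. \<Phi> g - \<Psi> g)"
proof -
  obtain C D where "\<And>g. g \<in> lip0_ball z \<Longrightarrow> norm (\<Phi> g) \<le> C"
    "\<And>g. g \<in> lip0_ball z \<Longrightarrow> norm (\<Psi> g) \<le> D"
    using assms by (auto simp: ball_bounded_def)
  then show ?thesis
    by (intro ball_boundedI[of _ _ "C + D"] order_trans[OF norm_triangle_ineq4] add_mono) auto
qed

lemma ball_bounded_evalf_sum: "ball_bounded z (\<lambda>g. \<Sum>p\<in>P. a p * evalf z p g)"
proof (rule ball_boundedI)
  fix g :: "'a \<Rightarrow> 'b" assume g: "g \<in> lip0_ball z"
  have "norm (g p) \<le> dist p z" for p
    using lip0_ballD(2)[OF g, of p z] lip0_ballD(1)[OF g] by simp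
  then show "norm (\<Sum>p\<in>P. a p * evalf z p g) \<le> (\<Sum>p\<in>P. norm (a p) * dist p z)"
    using lip0_ballD(3)[OF g]
    by (intro order_trans[OF norm_sum] sum_mono) (auto simp: evalf_def norm_mult intro!: mult_left_mono)
qed

lemma le_dual_norm:
  assumes "ball_bounded z \<Phi>" "g \<in> lip0_ball z"
  shows "norm (\<Phi> g) \<le> dual_norm z \<Phi>"
  unfolding dual_norm_def using assms
  by (intro cSUP_upper) (auto simp: ball_bounded_def bdd_above_def)

lemma dual_norm_le:
  assumes "\<And>g. g \<in> lip0_ball z \<Longrightarrow> norm (\<Phi> g) \<le> C"
  shows "dual_norm z \<Phi> \<le> C"
  unfolding dual_norm_def using assms lip0_ball_0 by (intro cSUP_least) auto

lemma dual_norm_nonneg: "ball_bounded z \<Phi> \<Longrightarrow> 0 \<le> dual_norm z \<Phi>"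
  using le_dual_norm[OF _ lip0_ball_0] norm_ge_zero order_trans by blast

text \<open>The function \<open>q\<close> divided by \<open>L\<close> lies in the unit ball, and the
  scalar is taken out by homogeneity. Asking for homogeneity at \<open>q\<close> alone makes the
  bound available for a functional minus a finite sum of evaluations.\<close>

lemma norm_le_lipschitz_mult_dual_norm:
  fixes \<Phi> :: "('a::metric_space \<Rightarrow> 'k::real_normed_field) \<Rightarrow> 'k"
  assumes bdd: "ball_bounded z \<Phi>"
    and hom: "\<And>c. \<Phi> (\<lambda>x. c * q x) = c * \<Phi> q"
    and q: "q z = 0" "\<And>x y. norm (q x - q y) \<le> L * dist x y" and "L > 0"
  shows "norm (\<Phi> q) \<le> L * dual_norm z \<Phi>"
proof -
  from le_dual_norm[OF bdd lip0_normalise[OF q \<open>L > 0\<close>]] have "norm (of_real (1 / L) * \<Phi> q) \<le> dual_norm z \<Phi>"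
    by (simp only: hom)
  then show ?thesis using \<open>L > 0\<close> by (simp add: norm_mult norm_divide field_simps)
qed

section \<open>Molecules as elements of the free space\<close>

lemma molecule_in_free_space:
  fixes x y z :: "'a::metric_space"
  assumes "x \<noteq> y"
  defines "m \<equiv> \<lambda>g :: 'a \<Rightarrow> 'k::real_normed_field. (evalf z x g - evalf z y g) / of_real (dist x y)"
  shows "m \<in> free_space z" and "dual_norm z m \<le> 1"
proof -
  have bd: "norm (m g) \<le> 1" if "g \<in> lip0_ball z" for g
    using lip0_ballD[OF that] assms(1) by (auto simp: m_def evalf_def norm_divide divide_le_eq_1)
  then show "dual_norm z m \<le> 1" by (rule dual_norm_le)
  have "m \<in> lip0_dual z"
    unfolding lip0_dual_def
  proof (intro CollectI conjI)
    show "\<exists>C. \<forall>g\<in>lip0_ball z. norm (m g) \<le> C" using bd by blast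
  qed (auto simp: m_def evalf_def lip0_add lip0_mult diff_divide_distrib add_divide_distrib right_diff_distrib)
  \<comment> \<open>The molecule is itself a combination of two evaluations with coefficients plus
    and minus 1/d(x,y), so the same witness has error zero for every \<epsilon>.\<close>
  moreover have "dual_norm z (\<lambda>g. m g - (\<Sum>p\<in>{x, y}. (if p = x then 1 else - 1) / of_real (dist x y) * evalf z p g)) \<le> 0"
    using assms(1) by (intro dual_norm_le) (simp add: m_def diff_divide_distrib)
  ultimately show "m \<in> free_space z"
    unfolding free_space_def
    by (intro CollectI conjI allI impI exI[of _ "{x, y}"] exI[of _ "\<lambda>p. (if p = x then 1 else - 1) / of_real (dist x y)"]) auto
qed

section \<open>Compactness implies the metric conditions\<close>

text \<open>Along a subsequence the images of the molecules converge to some \<open>\<Psi>\<close>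
  in the free space, and \<open>\<Psi>\<close> is close to a combination of evaluations at finitely
  many points \<open>P\<close>. A function vanishing on \<open>P\<close> annihilates that
  combination, so the images are small on it. Half of \<open>\<eta>\<close> pays for each of the two
  approximations.\<close>

lemma free_lift_compact_slopes:
  fixes f :: "'a::metric_space \<Rightarrow> 'b::metric_space" and xs ys :: "nat \<Rightarrow> 'a"
  assumes compact: "free_lift_compact TYPE('k::real_normed_field) zM zN f"
    and lip: "C-lipschitz_on UNIV f" and base: "f zM = zN"
    and ne: "\<And>n. xs n \<noteq> ys n"
  obtains r where "strict_mono r"
    "\<forall>\<eta>>0. \<exists>P. finite P \<and> (\<forall>\<^sub>F n in sequentially. \<forall>g :: 'b \<Rightarrow> 'k. g \<in> lip0_ball zN \<longrightarrow>
        (\<forall>p\<in>P. g p = 0) \<longrightarrow> norm (g (f (xs (r n))) - g (f (ys (r n)))) < \<eta> * dist (xs (r n)) (ys (r n)))"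
proof -
  define m where "m n = (\<lambda>g :: 'a \<Rightarrow> 'k. (evalf zM (xs n) g - evalf zM (ys n) g) / of_real (dist (xs n) (ys n)))" for n
  have m: "\<forall>n. m n \<in> free_space zM \<and> dual_norm zM (m n) \<le> 1"
    unfolding m_def using molecule_in_free_space[OF ne] by blast
  obtain r \<Psi> where r: "strict_mono r" and \<Psi>: "\<Psi> \<in> free_space zN"
    and lim: "(\<lambda>n. dual_norm zN (\<lambda>g. free_lift zN f (m (r n)) g - \<Psi> g)) \<longlonglongrightarrow> 0"
    using compact[unfolded free_lift_compact_def, THEN spec, THEN mp, OF m] by (elim exE conjE)
  have lift: "free_lift zN f (m n) g = (g (f (xs n)) - g (f (ys n))) / of_real (dist (xs n) (ys n))"
    if "g \<in> lip0_ball zN" for n g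
    using lip0_compose[OF lip base lip0_ballD(3)[OF that]] lip0_ballD(3)[OF that]
    by (simp add: free_lift_def m_def evalf_def)
  have Cdist: "dist (f x) (f y) \<le> C * dist x y" for x y
    using lipschitz_onD[OF lip] by simp
  have bdd: "ball_bounded zN (free_lift zN f (m n))" for n
  proof (rule ball_boundedI)
    fix g :: "'b \<Rightarrow> 'k" assume g: "g \<in> lip0_ball zN"
    show "norm (free_lift zN f (m n) g) \<le> C"
      using order_trans[OF lip0_ballD(2)[OF g] Cdist] ne by (simp add: lift[OF g] norm_divide divide_le_eq)
  qed
  have \<Psi>app: "\<forall>\<epsilon>>0. \<exists>P a. finite P \<and> dual_norm zN (\<lambda>g. \<Psi> g - (\<Sum>p\<in>P. a p * evalf zN p g)) < \<epsilon>"
    using \<Psi> unfolding free_space_def mem_Collect_eq by (rule conjunct2)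
  have \<Psi>bdd: "ball_bounded zN \<Psi>"
    using \<Psi> by (simp add: free_space_def lip0_dual_ball_bounded)
  have "\<exists>P. finite P \<and> (\<forall>\<^sub>F n in sequentially. \<forall>g :: 'b \<Rightarrow> 'k. g \<in> lip0_ball zN \<longrightarrow>
        (\<forall>p\<in>P. g p = 0) \<longrightarrow> norm (g (f (xs (r n))) - g (f (ys (r n)))) < \<eta> * dist (xs (r n)) (ys (r n)))"
    if "\<eta> > 0" for \<eta>
  proof -
    obtain P a where P: "finite P" "dual_norm zN (\<lambda>g. \<Psi> g - (\<Sum>p\<in>P. a p * evalf zN p g)) < \<eta>/2"
      using \<Psi>app[rule_format, OF half_gt_zero[OF \<open>\<eta> > 0\<close>]] by (elim exE conjE)
    have "\<forall>\<^sub>F n in sequentially. dual_norm zN (\<lambda>g. free_lift zN f (m (r n)) g - \<Psi> g) < \<eta>/2"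
      using order_tendstoD(2)[OF lim, of "\<eta>/2"] \<open>\<eta> > 0\<close> by simp
    then have "\<forall>\<^sub>F n in sequentially. \<forall>g :: 'b \<Rightarrow> 'k. g \<in> lip0_ball zN \<longrightarrow>
        (\<forall>p\<in>P. g p = 0) \<longrightarrow> norm (g (f (xs (r n))) - g (f (ys (r n)))) < \<eta> * dist (xs (r n)) (ys (r n))"
    proof (rule eventually_mono, intro allI impI)
      fix n and g :: "'b \<Rightarrow> 'k"
      assume n: "dual_norm zN (\<lambda>g. free_lift zN f (m (r n)) g - \<Psi> g) < \<eta>/2"
        and g: "g \<in> lip0_ball zN" and g0: "\<forall>p\<in>P. g p = 0"
      have "norm (\<Psi> g - (\<Sum>p\<in>P. a p * evalf zN p g)) < \<eta>/2"
        using le_dual_norm[OF ball_bounded_diff[OF \<Psi>bdd ball_bounded_evalf_sum] g] P(2)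
        by (rule le_less_trans)
      moreover have "(\<Sum>p\<in>P. a p * evalf zN p g) = 0"
        using g0 by (intro sum.neutral) (simp add: evalf_def)
      moreover have "norm (free_lift zN f (m (r n)) g - \<Psi> g) < \<eta>/2"
        using le_dual_norm[OF ball_bounded_diff[OF bdd \<Psi>bdd] g] n by (rule le_less_trans)
      ultimately have "norm (free_lift zN f (m (r n)) g) < \<eta>"
        using norm_triangle_sub[of "free_lift zN f (m (r n)) g" "\<Psi> g"] by simp
      then show "norm (g (f (xs (r n))) - g (f (ys (r n)))) < \<eta> * dist (xs (r n)) (ys (r n))"
        using ne by (simp add: lift[OF g] norm_divide divide_less_eq)
    qed
    then show ?thesis using P(1) by blast
  qed
  then show thesis using that[OF r] by simp
qed

section \<open>Bump functions and limits of steep pairs\<close>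

text \<open>The bump around \<open>u\<close> has height and radius \<open>\<rho>\<close>; the bound
  on \<open>\<rho>\<close> makes it vanish at the base point.\<close>

lemma bump_in_lip0_ball:
  assumes "\<rho> \<le> dist u z"
  shows "(\<lambda>w. of_real (max 0 (\<rho> - dist w u)) :: 'k::real_normed_field) \<in> lip0_ball z"
proof (rule lip0_ballI)
  fix x y
  have "\<bar>max 0 (\<rho> - dist x u) - max 0 (\<rho> - dist y u)\<bar> \<le> dist x y"
    using dist_triangle[of x u y] dist_triangle[of y u x] by (auto simp: max_def dist_commute)
  then show "norm (of_real (max 0 (\<rho> - dist x u)) - (of_real (max 0 (\<rho> - dist y u)) :: 'k)) \<le> dist x y"
    by (simp only: of_real_diff[symmetric] norm_of_real)
qed (use assms in \<open>simp add: dist_commute\<close>)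

text \<open>Otherwise the bump around \<open>u\<close> of radius \<alpha> d(u,v) would vanish on
  \<open>P\<close> and at the base point, and also at \<open>v\<close> because \<alpha> < 1, while
  its value at \<open>u\<close> is exactly \<alpha> d(u,v). The base point joins \<open>P\<close>
  because the bump has to vanish there too.\<close>

lemma near_finite_set_if_slopes_small:
  fixes u v z :: "'b::metric_space"
  assumes small: "\<And>g :: 'b \<Rightarrow> 'k::real_normed_field. g \<in> lip0_ball z \<Longrightarrow> \<forall>p\<in>P. g p = 0 \<Longrightarrow>
      norm (g u - g v) < \<alpha> * dist u v"
    and "0 < \<alpha>" "\<alpha> < 1"
  shows "\<exists>p\<in>insert z P. dist u p < \<alpha> * dist u v"
proof (rule ccontr)
  assume "\<not> ?thesis"
  then have far: "\<alpha> * dist u v \<le> dist u p" if "p \<in> insert z P" for p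
    using that by force
  define g :: "'b \<Rightarrow> 'k" where "g = (\<lambda>w. of_real (max 0 (\<alpha> * dist u v - dist w u)))"
  have "g \<in> lip0_ball z"
    unfolding g_def using far by (intro bump_in_lip0_ball) simp
  moreover have "\<forall>p\<in>P. g p = 0"
    using far by (auto simp: g_def dist_commute)
  ultimately have "norm (g u - g v) < \<alpha> * dist u v" by (rule small)
  moreover have "g v = 0" 
    using \<open>\<alpha> < 1\<close> mult_right_mono[of \<alpha> 1 "dist u v"] by (simp add: g_def dist_commute)
  moreover have "norm (g u) = \<alpha> * dist u v" 
    using \<open>\<alpha> > 0\<close> by (simp add: g_def norm_mult)
  ultimately show False by simp
qed

text \<open>Steepness turns smallness relative to d(x,y) into smallness relative to d(f x, f y), so
  bumps place both image points near a finite set. Taking \<alpha> = 1/4 bounds the image distances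
  from both sides; small \<alpha> then gives total boundedness. Completeness provides limits, and
  the lower bound keeps them apart.\<close>

lemma free_lift_compact_imp_convergent_pairs:
  fixes f :: "'a::metric_space \<Rightarrow> 'b::complete_space" and xs ys :: "nat \<Rightarrow> 'a"
  assumes compact: "free_lift_compact TYPE('k::real_normed_field) zM zN f"
    and lip: "C-lipschitz_on UNIV f" and base: "f zM = zN"
    and ne: "\<And>n. xs n \<noteq> ys n" and "c > 0"
    and steep: "\<And>n. c * dist (xs n) (ys n) \<le> dist (f (xs n)) (f (ys n))"
  obtains r u v where "strict_mono r" "(\<lambda>n. f (xs (r n))) \<longlonglongrightarrow> u" "(\<lambda>n. f (ys (r n))) \<longlonglongrightarrow> v" "u \<noteq> v"
proof -
  obtain r where r: "strict_mono r" and small: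
    "\<forall>\<eta>>0. \<exists>P. finite P \<and> (\<forall>\<^sub>F n in sequentially. \<forall>g :: 'b \<Rightarrow> 'k. g \<in> lip0_ball zN \<longrightarrow>
        (\<forall>p\<in>P. g p = 0) \<longrightarrow> norm (g (f (xs (r n))) - g (f (ys (r n)))) < \<eta> * dist (xs (r n)) (ys (r n)))"
    by (rule free_lift_compact_slopes[where xs = xs and ys = ys, OF compact lip base ne])
  define u where "u n = f (xs (r n))" for n
  define v where "v n = f (ys (r n))" for n
  have near: "\<exists>P. finite P \<and> (\<forall>\<^sub>F n in sequentially. 
      (\<exists>p\<in>P. dist (u n) p < \<alpha> * dist (u n) (v n)) \<and> (\<exists>q\<in>P. dist (v n) q < \<alpha> * dist (u n) (v n)))"
    if \<alpha>: "0 < \<alpha>" "\<alpha> < 1" for \<alpha>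
  proof -
    obtain P where P: "finite P" and ev: "\<forall>\<^sub>F n in sequentially. \<forall>g :: 'b \<Rightarrow> 'k. g \<in> lip0_ball zN \<longrightarrow>
        (\<forall>p\<in>P. g p = 0) \<longrightarrow> norm (g (u n) - g (v n)) < (\<alpha> * c) * dist (xs (r n)) (ys (r n))"
      using small[rule_format, of "\<alpha> * c"] \<alpha>(1) \<open>c > 0\<close> unfolding u_def v_def by auto
    have "\<forall>\<^sub>F n in sequentially. 
      (\<exists>p\<in>insert zN P. dist (u n) p < \<alpha> * dist (u n) (v n)) \<and> (\<exists>q\<in>insert zN P. dist (v n) q < \<alpha> * dist (u n) (v n))"
      using ev
    proof (rule eventually_mono)
      fix n
      assume n: "\<forall>g :: 'b \<Rightarrow> 'k. g \<in> lip0_ball zN \<longrightarrow>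
        (\<forall>p\<in>P. g p = 0) \<longrightarrow> norm (g (u n) - g (v n)) < (\<alpha> * c) * dist (xs (r n)) (ys (r n))"
      have "(\<alpha> * c) * dist (xs (r n)) (ys (r n)) \<le> \<alpha> * dist (u n) (v n)"
        using mult_left_mono[OF steep, of \<alpha> "r n"] \<alpha>(1) by (simp add: u_def v_def mult.assoc)
      then have *: "norm (g (u n) - g (v n)) < \<alpha> * dist (u n) (v n)" 
        if "g \<in> lip0_ball zN" "\<forall>p\<in>P. g p = 0" for g :: "'b \<Rightarrow> 'k"
        using n that less_le_trans by blast
      then have "norm (g (v n) - g (u n)) < \<alpha> * dist (v n) (u n)" 
        if "g \<in> lip0_ball zN" "\<forall>p\<in>P. g p = 0" for g :: "'b \<Rightarrow> 'k"
        using that by (simp add: norm_minus_commute dist_commute)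
      then have "\<exists>q\<in>insert zN P. dist (v n) q < \<alpha> * dist (v n) (u n)"
        using near_finite_set_if_slopes_small \<alpha> by blast
      moreover have "\<exists>p\<in>insert zN P. dist (u n) p < \<alpha> * dist (u n) (v n)"
        using near_finite_set_if_slopes_small * \<alpha> by blast
      ultimately show "(\<exists>p\<in>insert zN P. dist (u n) p < \<alpha> * dist (u n) (v n)) \<and>
          (\<exists>q\<in>insert zN P. dist (v n) q < \<alpha> * dist (u n) (v n))"
        by (simp add: dist_commute)
    qed
    then show ?thesis using P by blast
  qed
  \<comment> \<open>Both points are so close to the finite set that their nearest points differ, hence their
    distance is comparable to one of finitely many positive numbers.\<close>
  obtain \<delta> D where "\<delta> > 0" and dists: "\<forall>\<^sub>F n in sequentially. \<delta> \<le> dist (u n) (v n) \<and> dist (u n) (v n) \<le> D"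
  proof -
    obtain P where P: "finite P" and ev: "\<forall>\<^sub>F n in sequentially. 
      (\<exists>p\<in>P. dist (u n) p < 1/4 * dist (u n) (v n)) \<and> (\<exists>q\<in>P. dist (v n) q < 1/4 * dist (u n) (v n))"
      using near[of "1/4"] by auto
    \<comment> \<open>The candidate values of d(p,q): the positive distances within
      \<open>P\<close>, with 1 added so that \<open>Min\<close> and \<open>Max\<close> range over a
      nonempty set.\<close>
    define Q where "Q = insert 1 ((\<lambda>(p, q). dist p q) ` (P \<times> P) \<inter> {0<..})"
    have Q: "finite Q" "Q \<noteq> {}" "\<And>t. t \<in> Q \<Longrightarrow> t > 0"
      using P by (auto simp: Q_def)
    have "\<forall>\<^sub>F n in sequentially. Min Q / 2 \<le> dist (u n) (v n) \<and> dist (u n) (v n) \<le> 2 * Max Q"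
      using ev
    proof (rule eventually_mono)
      fix n assume "(\<exists>p\<in>P. dist (u n) p < 1/4 * dist (u n) (v n)) \<and> (\<exists>q\<in>P. dist (v n) q < 1/4 * dist (u n) (v n))"
      then obtain p q where pq: "p \<in> P" "q \<in> P" "dist (u n) p < 1/4 * dist (u n) (v n)"
        "dist (v n) q < 1/4 * dist (u n) (v n)" by blast
      have "dist (u n) (v n) \<le> dist (u n) p + dist p q + dist (v n) q"
        "dist p q \<le> dist (u n) p + dist (u n) (v n) + dist (v n) q"
        by metric+
      \<comment> \<open>Two errors below a quarter of d(u,v) leave at least half of it for d(p,q)
        and add at most half. Strictness of these errors forces d(u,v) > 0, hence p and q
        differ.\<close>
      then have *: "dist p q \<le> 2 * dist (u n) (v n)" "dist (u n) (v n) \<le> 2 * dist p q" "dist p q > 0"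
        using pq(3,4) zero_le_dist[of "u n" p] by linarith+
      then have "dist p q \<in> Q" using pq(1,2) by (force simp: Q_def)
      then show "Min Q / 2 \<le> dist (u n) (v n) \<and> dist (u n) (v n) \<le> 2 * Max Q"
        using * Min_le[OF Q(1)] Max_ge[OF Q(1)] by force
    qed
    moreover have "Min Q / 2 > 0" using Q by simp
    ultimately show thesis using that by blast
  qed
  have tb: "\<exists>k. finite k \<and> (\<forall>n. (\<exists>p\<in>k. dist p (u n) < e) \<and> (\<exists>q\<in>k. dist q (v n) < e))" if "e > 0" for e
  proof -
    \<comment> \<open>Chosen below 1 and with \<alpha> (|D| + 1) \<le> e; the denominator is
      positive whatever the sign of \<open>D\<close>.\<close>
    define \<alpha> where "\<alpha> = min (1/2) (e / (\<bar>D\<bar> + 1))"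
    have \<alpha>: "0 < \<alpha>" "\<alpha> < 1" using \<open>e > 0\<close> by (auto simp: \<alpha>_def)
    have "\<alpha> * (\<bar>D\<bar> + 1) \<le> e / (\<bar>D\<bar> + 1) * (\<bar>D\<bar> + 1)"
      by (intro mult_right_mono) (auto simp: \<alpha>_def)
    then have \<alpha>e: "\<alpha> * (\<bar>D\<bar> + 1) \<le> e" by simp
    obtain P where P: "finite P" and ev: "\<forall>\<^sub>F n in sequentially. 
      (\<exists>p\<in>P. dist (u n) p < \<alpha> * dist (u n) (v n)) \<and> (\<exists>q\<in>P. dist (v n) q < \<alpha> * dist (u n) (v n))"
      using near[OF \<alpha>] by auto
    from dists ev have "\<forall>\<^sub>F n in sequentially. (\<exists>p\<in>P. dist p (u n) < e) \<and> (\<exists>q\<in>P. dist q (v n) < e)"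
    proof eventually_elim
      case (elim n)
      have "\<alpha> * dist (u n) (v n) \<le> \<alpha> * (\<bar>D\<bar> + 1)"
        using elim(1) \<alpha> by (intro mult_left_mono) auto
      also note \<alpha>e
      finally have "\<alpha> * dist (u n) (v n) \<le> e" .
      with elim(2) show ?case by (metis dist_commute less_le_trans)
    qed
    then obtain N where N: "\<And>n. n \<ge> N \<Longrightarrow> (\<exists>p\<in>P. dist p (u n) < e) \<and> (\<exists>q\<in>P. dist q (v n) < e)"
      by (auto simp: eventually_sequentially)
    show ?thesis
    \<comment> \<open>The finitely many terms before \<open>N\<close> serve as their own
      centres.\<close>
    proof (intro exI[of _ "P \<union> u ` {..<N} \<union> v ` {..<N}"] conjI allI)
      fix n
      show "\<exists>p\<in>P \<union> u ` {..<N} \<union> v ` {..<N}. dist p (u n) < e" "\<exists>p\<in>P \<union> u ` {..<N} \<union> v ` {..<N}. dist p (v n) < e"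
        using N[of n] \<open>e > 0\<close> by (cases "n < N"; force)+
    qed (use P in auto)
  qed
  have "totally_bounded (range u)" "totally_bounded (range v)"
    unfolding totally_bounded_metric
  proof (safe)
    fix e :: real assume "e > 0"
    with tb obtain k where k: "finite k" "\<And>n. \<exists>p\<in>k. dist p (u n) < e" "\<And>n. \<exists>q\<in>k. dist q (v n) < e"
      by meson
    show "\<exists>k. finite k \<and> range u \<subseteq> (\<Union>x\<in>k. {y. dist x y < e})"
      using k by (intro exI[of _ k]) auto
    show "\<exists>k. finite k \<and> range v \<subseteq> (\<Union>x\<in>k. {y. dist x y < e})"
      using k by (intro exI[of _ k]) auto
  qed
  obtain r1 l1 where r1: "strict_mono r1" "(\<lambda>n. u (r1 n)) \<longlonglongrightarrow> l1"
    using totally_bounded_convergent_subseq[OF \<open>totally_bounded (range u)\<close>] by blast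
  obtain r2 l2 where r2: "strict_mono r2" "(\<lambda>n. v (r1 (r2 n))) \<longlonglongrightarrow> l2"
    using totally_bounded_convergent_subseq[OF \<open>totally_bounded (range v)\<close>, of "\<lambda>n. v (r1 n)"] by blast
  have l1: "(\<lambda>n. u (r1 (r2 n))) \<longlonglongrightarrow> l1"
    using LIMSEQ_subseq_LIMSEQ[OF r1(2) r2(1)] by (simp add: o_def)
  have sm: "strict_mono (\<lambda>n. r1 (r2 n))"
    using strict_mono_o[OF r1(1) r2(1)] by (simp add: o_def)
  have "\<forall>\<^sub>F n in sequentially. \<delta> \<le> dist (u (r1 (r2 n))) (v (r1 (r2 n)))"
    using eventually_compose_filterlim[OF dists filterlim_subseq[OF sm]] by (auto elim: eventually_mono)
  then have "\<delta> \<le> dist l1 l2"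
    using tendsto_dist[OF l1 r2(2)] by (intro tendsto_lowerbound) auto
  then have "l1 \<noteq> l2" using \<open>\<delta> > 0\<close> by auto
  moreover have "strict_mono (\<lambda>n. r (r1 (r2 n)))"
    using strict_mono_o[OF r sm] by (simp add: o_def)
  ultimately show thesis
    using that[of "\<lambda>n. r (r1 (r2 n))" l1 l2] l1 r2(2) by (simp add: u_def v_def)
qed

section \<open>Necessity of the three metric conditions\<close>

text \<open>If the image is not totally bounded, \<open>S\<close> contains a sequence with
  e-separated images. Distances in \<open>S\<close> are at most \<open>B\<close>, so consecutive
  terms form steep pairs with constant e/B, and a subsequence of the images converges, against the
  separation.\<close>

lemma free_lift_compact_imp_totally_bounded_image:
  fixes f :: "'a::metric_space \<Rightarrow> 'b::complete_space"
  assumes compact: "free_lift_compact TYPE('k::real_normed_field) zM zN f"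
    and lip: "C-lipschitz_on UNIV f" and base: "f zM = zN" and "bounded S"
  shows "totally_bounded (f ` S)"
  unfolding totally_bounded_metric
proof (rule ccontr)
  assume "\<not> (\<forall>e>0. \<exists>k. finite k \<and> f ` S \<subseteq> (\<Union>x\<in>k. {y. dist x y < e}))"
  then obtain e where "e > 0" and e: "\<And>k. finite k \<Longrightarrow> \<not> f ` S \<subseteq> (\<Union>x\<in>k. {y. dist x y < e})"
    by blast
  have "\<not> (\<exists>T. finite T \<and> T \<subseteq> S \<and> (\<forall>x\<in>S. \<exists>t\<in>T. \<not> e \<le> dist (f t) (f x)))"
  proof
    assume "\<exists>T. finite T \<and> T \<subseteq> S \<and> (\<forall>x\<in>S. \<exists>t\<in>T. \<not> e \<le> dist (f t) (f x))"
    then obtain T where "finite T" "\<forall>x\<in>S. \<exists>t\<in>T. \<not> e \<le> dist (f t) (f x)" by blast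
    then have "f ` S \<subseteq> (\<Union>x\<in>f ` T. {y. dist x y < e})" by force
    with e[of "f ` T"] \<open>finite T\<close> show False by blast
  qed
  then obtain s :: "nat \<Rightarrow> 'a" where s: "\<And>n. s n \<in> S" and sep: "\<And>m n. m < n \<Longrightarrow> e \<le> dist (f (s m)) (f (s n))"
    by (rule finite_net_or_separated_sequence[where R = "\<lambda>t x. e \<le> dist (f t) (f x)"]) blast
  obtain B where B: "\<And>x y. x \<in> S \<Longrightarrow> y \<in> S \<Longrightarrow> dist x y \<le> B"
    using \<open>bounded S\<close> bounded_two_points by metis
  have sep1: "e \<le> dist (f (s n)) (f (s (Suc n)))" for n by (rule sep) simp
  have ne: "s n \<noteq> s (Suc n)" for n
    using sep1[of n] \<open>e > 0\<close> by auto
  have "B > 0" using less_le_trans[OF _ B[OF s s, of 0 "Suc 0"], of 0] ne[of 0] by simp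
  obtain r u where r: "strict_mono r" "(\<lambda>n. f (s (r n))) \<longlonglongrightarrow> u"
  proof (rule free_lift_compact_imp_convergent_pairs[OF compact lip base ne, of "e / B"])
    show "e / B * dist (s n) (s (Suc n)) \<le> dist (f (s n)) (f (s (Suc n)))" for n
      using mult_left_mono[OF B[OF s s], of "e / B" n "Suc n"] \<open>e > 0\<close> \<open>B > 0\<close> sep1[of n] by simp
  qed (use \<open>e > 0\<close> \<open>B > 0\<close> in auto)
  then have "Cauchy (\<lambda>n. f (s (r n)))" by (auto intro: LIMSEQ_imp_Cauchy)
  then obtain N where "\<And>m n. m \<ge> N \<Longrightarrow> n \<ge> N \<Longrightarrow> dist (f (s (r m))) (f (s (r n))) < e"
    using \<open>e > 0\<close> unfolding Cauchy_def by blast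
  from this[of N "Suc N"] sep[of "r N" "r (Suc N)"] r(1) show False
    by (auto simp: strict_mono_def not_less[symmetric])
qed

text \<open>A failure gives steep pairs whose distances tend to 0. Their image distances tend to 0
  by the Lipschitz bound, yet along a subsequence the images converge to two distinct
  points.\<close>

lemma free_lift_compact_imp_uniformly_locally_flat:
  fixes f :: "'a::metric_space \<Rightarrow> 'b::complete_space"
  assumes compact: "free_lift_compact TYPE('k::real_normed_field) zM zN f"
    and lip: "C-lipschitz_on UNIV f" and base: "f zM = zN" and "\<epsilon> > 0"
  shows "\<exists>\<delta>>0. \<forall>x y. 0 < dist x y \<and> dist x y \<le> \<delta> \<longrightarrow> dist (f x) (f y) \<le> \<epsilon> * dist x y"
proof (rule ccontr)
  assume "\<not> ?thesis"
  then have "\<forall>\<delta>>0. \<exists>x y. 0 < dist x y \<and> dist x y \<le> \<delta> \<and> \<epsilon> * dist x y < dist (f x) (f y)"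
    by (metis not_le)
  then have "\<forall>n. \<exists>x y. 0 < dist x y \<and> dist x y \<le> inverse (real (Suc n)) \<and> \<epsilon> * dist x y < dist (f x) (f y)"
    by simp
  then obtain xs ys where xy: "\<And>n. 0 < dist (xs n) (ys n)" "\<And>n. dist (xs n) (ys n) \<le> inverse (real (Suc n))"
    "\<And>n. \<epsilon> * dist (xs n) (ys n) < dist (f (xs n)) (f (ys n))" by metis
  have ne: "xs n \<noteq> ys n" for n using xy(1)[of n] by auto
  have lim0: "(\<lambda>n. dist (xs n) (ys n)) \<longlonglongrightarrow> 0"
    by (rule tendsto_sandwich[OF _ _ tendsto_const LIMSEQ_inverse_real_of_nat]) (auto intro: always_eventually xy(2) simp del: of_nat_Suc)
  have lim0: "(\<lambda>n. dist (f (xs n)) (f (ys n))) \<longlonglongrightarrow> 0"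
    by (rule tendsto_sandwich[OF _ _ tendsto_const tendsto_mult_right_zero[OF lim0]])
      (auto intro: always_eventually lipschitz_onD[OF lip])
  obtain r u v where r: "strict_mono r" "(\<lambda>n. f (xs (r n))) \<longlonglongrightarrow> u" "(\<lambda>n. f (ys (r n))) \<longlonglongrightarrow> v" "u \<noteq> v"
    by (rule free_lift_compact_imp_convergent_pairs[where xs = xs and ys = ys,
          OF compact lip base ne \<open>\<epsilon> > 0\<close> less_imp_le[OF xy(3)]])
  have "(\<lambda>n. dist (f (xs (r n))) (f (ys (r n)))) \<longlonglongrightarrow> dist u v"
    by (intro tendsto_dist r)
  moreover have "(\<lambda>n. dist (f (xs (r n))) (f (ys (r n)))) \<longlonglongrightarrow> 0"
    using LIMSEQ_subseq_LIMSEQ[OF lim0 r(1)] by (simp add: o_def)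
  ultimately have "dist u v = 0" using LIMSEQ_unique by blast
  with \<open>u \<noteq> v\<close> show False by simp
qed

text \<open>A nonzero liminf makes the pairs steep from some index on, and steep pairs have images
  converging along a subsequence.\<close>

lemma free_lift_compact_imp_accumulation_or_flat:
  fixes f :: "'a::metric_space \<Rightarrow> 'b::complete_space" and xs ys :: "nat \<Rightarrow> 'a"
  assumes compact: "free_lift_compact TYPE('k::real_normed_field) zM zN f"
    and lip: "C-lipschitz_on UNIV f" and base: "f zM = zN" and ne: "\<And>n. xs n \<noteq> ys n"
  shows "(\<exists>p r. strict_mono r \<and> (\<lambda>n. (f (xs (r n)), f (ys (r n)))) \<longlonglongrightarrow> p) \<or>
      liminf (\<lambda>n. ereal (dist (f (xs n)) (f (ys n)) / dist (xs n) (ys n))) = 0"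
proof (rule disjCI)
  assume "liminf (\<lambda>n. ereal (dist (f (xs n)) (f (ys n)) / dist (xs n) (ys n))) \<noteq> 0"
  then obtain c where "c > 0" "\<forall>\<^sub>F n in sequentially. c \<le> dist (f (xs n)) (f (ys n)) / dist (xs n) (ys n)"
    using liminf_ereal_nonneg_neq_0[of "\<lambda>n. dist (f (xs n)) (f (ys n)) / dist (xs n) (ys n)"] by auto
  then obtain N where N: "\<And>n. n \<ge> N \<Longrightarrow> c \<le> dist (f (xs n)) (f (ys n)) / dist (xs n) (ys n)"
    by (auto simp: eventually_sequentially)
  \<comment> \<open>The shift by \<open>N\<close> discards the pairs that are not yet steep; it is
    absorbed into the final subsequence.\<close>
  obtain r u v where r: "strict_mono r" "(\<lambda>n. f (xs (r n + N))) \<longlonglongrightarrow> u" "(\<lambda>n. f (ys (r n + N))) \<longlonglongrightarrow> v"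
  proof (rule free_lift_compact_imp_convergent_pairs[OF compact lip base _ \<open>c > 0\<close>])
    show "c * dist (xs (n + N)) (ys (n + N)) \<le> dist (f (xs (n + N))) (f (ys (n + N)))" for n
      using N[of "n + N"] ne[of "n + N"] by (simp add: pos_le_divide_eq)
  qed (use ne in auto)
  show "\<exists>p r. strict_mono r \<and> (\<lambda>n. (f (xs (r n)), f (ys (r n)))) \<longlonglongrightarrow> p"
    using r(1) tendsto_Pair[OF r(2,3)]
    by (intro exI[of _ "(u, v)"] exI[of _ "\<lambda>n. r n + N"]) (auto simp: strict_mono_def)
qed

section \<open>The metric conditions imply compactness\<close>

text \<open>The constant \<open>C\<close> is positive so that errors can be rescaled by dividing by
  it.\<close>

locale locally_flat_lipschitz =
  fixes f :: "'a::metric_space \<Rightarrow> 'b::complete_space" and zM :: 'a and zN :: 'b and C :: real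
  assumes C_pos: "C > 0"
    and lip: "\<And>x y. dist (f x) (f y) \<le> C * dist x y"
    and base: "f zM = zN"
    and image_totally_bounded: "\<And>S. bounded S \<Longrightarrow> totally_bounded (f ` S)"
    and locally_flat: "\<And>\<epsilon>. \<epsilon> > 0 \<Longrightarrow> \<exists>\<delta>>0. \<forall>x y. 0 < dist x y \<and> dist x y \<le> \<delta> \<longrightarrow>
          dist (f x) (f y) \<le> \<epsilon> * dist x y"
    and at_infinity: "\<And>xs ys :: nat \<Rightarrow> 'a. (\<And>n. xs n \<noteq> ys n) \<Longrightarrow>
        filterlim (\<lambda>n. dist (xs n) zM) at_top sequentially \<Longrightarrow>
        filterlim (\<lambda>n. dist (ys n) zM) at_top sequentially \<Longrightarrow>
        (\<exists>p r. strict_mono r \<and> (\<lambda>n. (f (xs (r n)), f (ys (r n)))) \<longlonglongrightarrow> p) \<or>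
        liminf (\<lambda>n. ereal (dist (f (xs n)) (f (ys n)) / dist (xs n) (ys n))) = 0"
begin

section \<open>Steep pairs under the metric conditions\<close>

text \<open>Steepness keeps all quotients at least \<open>c\<close>, which excludes the liminf
  alternative of \<open>at_infinity\<close>.\<close>

lemma steep_at_infinity:
  fixes xs ys :: "nat \<Rightarrow> 'a"
  assumes ne: "\<And>n. xs n \<noteq> ys n"
    and inf: "filterlim (\<lambda>n. dist (xs n) zM) at_top sequentially"
      "filterlim (\<lambda>n. dist (ys n) zM) at_top sequentially"
    and "c > 0" and steep: "\<And>n. c * dist (xs n) (ys n) \<le> dist (f (xs n)) (f (ys n))"
  obtains r u v where "strict_mono r" "(\<lambda>n. f (xs (r n))) \<longlonglongrightarrow> u" "(\<lambda>n. f (ys (r n))) \<longlonglongrightarrow> v"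
proof -
  have "ereal c \<le> liminf (\<lambda>n. ereal (dist (f (xs n)) (f (ys n)) / dist (xs n) (ys n)))"
    using steep ne by (intro Liminf_bounded always_eventually allI) (simp add: pos_le_divide_eq)
  then have "liminf (\<lambda>n. ereal (dist (f (xs n)) (f (ys n)) / dist (xs n) (ys n))) \<noteq> 0"
    using \<open>c > 0\<close> by (auto simp: zero_ereal_def)
  then obtain p r where r: "strict_mono r" and p: "(\<lambda>n. (f (xs (r n)), f (ys (r n)))) \<longlonglongrightarrow> p"
    using at_infinity[OF ne inf] by blast
  show thesis
    using that[OF r] tendsto_fst[OF p] tendsto_snd[OF p] by simp
qed

text \<open>A bounded partner forces d(f(ys n), zN) to grow at least linearly in d(ys n, zM). Steep
  pairs formed within \<open>ys\<close> escape to infinity at both ends, so a subsequence of these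
  images would converge, contradicting the growth.\<close>

lemma no_steep_mixed_pairs:
  fixes xs ys :: "nat \<Rightarrow> 'a"
  assumes bdd: "\<And>n. dist (xs n) zM \<le> B"
    and inf: "filterlim (\<lambda>n. dist (ys n) zM) at_top sequentially"
    and "c > 0" and steep: "\<And>n. c * dist (xs n) (ys n) \<le> dist (f (xs n)) (f (ys n))"
  shows False
proof -
  \<comment> \<open>The cost of replacing \<open>xs n\<close> by the base point: at most
    \<open>c * B\<close> on the side of M and \<open>C * B\<close> on the side of N.\<close>
  define K where "K = (c + C) * B"
  have "B \<ge> 0" using bdd[of 0] zero_le_dist order_trans by blast
  then have "K \<ge> 0" using \<open>c > 0\<close> C_pos by (simp add: K_def)
  have lower: "c * dist (ys n) zM - K \<le> dist (f (ys n)) zN" for n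
  proof -
    have "c * dist (ys n) zM \<le> c * (dist (xs n) (ys n) + B)"
      using \<open>c > 0\<close> bdd[of n] dist_triangle[of "ys n" zM "xs n"]
      by (intro mult_left_mono) (auto simp: dist_commute)
    moreover have "dist (f (xs n)) (f (ys n)) \<le> dist (f (xs n)) zN + dist (f (ys n)) zN"
      by (rule dist_triangle2)
    moreover have "dist (f (xs n)) zN \<le> C * B"
      using lip[of "xs n" zM] base order_trans[OF _ mult_left_mono[OF bdd[of n], of C]] C_pos by simp
    ultimately show ?thesis
      using steep[of n] by (simp add: K_def algebra_simps)
  qed
  \<comment> \<open>The summand 2 makes the partner at least twice as far from the base point; the
    other summand makes its image's lower bound dominate both \<open>K\<close> and the Lipschitz
    bound for the nearer image.\<close>
  define L where "L = 2 + 2 * (K + C) / c"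
  \<comment> \<open>Pairing each point with one much farther away gives steep pairs escaping to infinity
    at both ends.\<close>
  have "\<exists>k\<ge>n. L * (dist (ys n) zM + 1) \<le> dist (ys k) zM" for n
    using inf unfolding filterlim_at_top eventually_sequentially by (meson nle_le)
  then obtain m where m: "\<And>n. n \<le> m n" "\<And>n. L * (dist (ys n) zM + 1) \<le> dist (ys (m n)) zM"
    by metis
  have far: "2 * dist (ys n) zM + 2 \<le> dist (ys (m n)) zM"
    "2 * (K + C * dist (ys n) zM) \<le> c * dist (ys (m n)) zM" for n
  proof -
    define d where "d = dist (ys n) zM"
    have "d \<ge> 0" by (simp add: d_def)
    have "2 * (d + 1) \<le> L * (d + 1)"
      using \<open>d \<ge> 0\<close> \<open>K \<ge> 0\<close> C_pos \<open>c > 0\<close> by (intro mult_right_mono) (auto simp: L_def)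
    then show "2 * dist (ys n) zM + 2 \<le> dist (ys (m n)) zM"
      using m(2)[of n] by (simp add: d_def)
    have "2 * (K + C * d) \<le> 2 * (K + C) * (d + 1)"
      using \<open>d \<ge> 0\<close> \<open>K \<ge> 0\<close> C_pos by (simp add: algebra_simps)
    also have "\<dots> \<le> c * L * (d + 1)"
      using \<open>d \<ge> 0\<close> \<open>c > 0\<close> by (intro mult_right_mono) (auto simp: L_def field_simps)
    also have "\<dots> \<le> c * dist (ys (m n)) zM"
      using mult_left_mono[OF m(2)[of n], of c] \<open>c > 0\<close> by (simp add: d_def mult.assoc)
    finally show "2 * (K + C * dist (ys n) zM) \<le> c * dist (ys (m n)) zM"
      by (simp add: d_def)
  qed
  have ne: "ys (m n) \<noteq> ys n" for n
    using far(1)[of n] zero_le_dist[of "ys n" zM] by fastforce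
  \<comment> \<open>The image distance is at least c d - K - C d', with d and d' the distances of
    the far and near point from \<open>zM\<close>. This is at least c d / 2, while the points are at
    most 2 d apart; hence the factor c/4.\<close>
  have steep': "c / 4 * dist (ys (m n)) (ys n) \<le> dist (f (ys (m n))) (f (ys n))" for n
  proof -
    have "dist (ys (m n)) (ys n) \<le> dist (ys (m n)) zM + dist (ys n) zM"
      by (rule dist_triangle2)
    also have "\<dots> \<le> dist (ys (m n)) zM + dist (ys (m n)) zM"
      using far(1)[of n] zero_le_dist[of "ys n" zM] by (intro add_left_mono) linarith
    finally have "c / 4 * dist (ys (m n)) (ys n) \<le> c / 4 * (dist (ys (m n)) zM + dist (ys (m n)) zM)"
      using \<open>c > 0\<close> by (intro mult_left_mono) auto
    moreover have "dist (f (ys (m n))) zN \<le> dist (f (ys (m n))) (f (ys n)) + dist (f (ys n)) zN"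
      by (rule dist_triangle)
    moreover have "dist (f (ys n)) zN \<le> C * dist (ys n) zM"
      using lip[of "ys n" zM] base by simp
    ultimately show ?thesis
      using lower[of "m n"] far(2)[of n] by simp
  qed
  have "filterlim m at_top sequentially"
    using m(1) by (intro filterlim_at_top_mono[OF filterlim_ident]) (auto intro: always_eventually)
  then have inf': "filterlim (\<lambda>n. dist (ys (m n)) zM) at_top sequentially"
    using filterlim_compose[OF inf] by blast
  obtain r v where r: "strict_mono r" and v: "(\<lambda>n. f (ys (r n))) \<longlonglongrightarrow> v"
    using steep_at_infinity[where xs = "\<lambda>n. ys (m n)" and ys = ys, OF ne inf' inf _ steep'] \<open>c > 0\<close>
    by (metis divide_pos_pos zero_less_numeral)
  have "(\<lambda>n. dist (f (ys (r n))) zN) \<longlonglongrightarrow> dist v zN"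
    by (intro tendsto_intros v)
  then have "\<forall>\<^sub>F n in sequentially. dist (f (ys (r n))) zN < dist v zN + 1"
    by (rule order_tendstoD) simp
  moreover have "filterlim (\<lambda>n. dist (ys (r n)) zM) at_top sequentially"
    using filterlim_compose[OF inf filterlim_subseq[OF r]] .
  then have "\<forall>\<^sub>F n in sequentially. (dist v zN + 1 + K) / c \<le> dist (ys (r n)) zM"
    by (simp add: filterlim_at_top)
  ultimately have "\<forall>\<^sub>F n in sequentially. False"
  proof eventually_elim
    case (elim n)
    then show ?case
      using lower[of "r n"] \<open>c > 0\<close> by (simp add: divide_le_eq mult.commute)
  qed
  then show False by simp
qed

text \<open>Three cases up to symmetry: if both coordinates are bounded along a subsequence, images
  of balls are totally bounded; if only one is, the pairs cannot be steep; if both escape, the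
  condition at infinity applies.\<close>

lemma steep_pairs_images_converge:
  fixes xs ys :: "nat \<Rightarrow> 'a"
  assumes ne: "\<And>n. xs n \<noteq> ys n" and "c > 0"
    and steep: "\<And>n. c * dist (xs n) (ys n) \<le> dist (f (xs n)) (f (ys n))"
  obtains r u v where "strict_mono r" "(\<lambda>n. f (xs (r n))) \<longlonglongrightarrow> u" "(\<lambda>n. f (ys (r n))) \<longlonglongrightarrow> v"
proof -
  have cball: "totally_bounded (f ` cball zM B)" for B
    by (intro image_totally_bounded bounded_cball)
  show thesis
  proof (cases "\<lambda>n. dist (xs n) zM" rule: bounded_or_unbounded_subseq)
    case (bounded r1 B1)
    note r1 = this
    show thesis
    proof (cases "\<lambda>n. dist (ys (r1 n)) zM" rule: bounded_or_unbounded_subseq)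
      case (bounded r2 B2)
      have *: "f (xs (r1 (r2 n))) \<in> f ` cball zM B1" for n
        using r1(2)[of "r2 n"] by (simp add: dist_commute)
      obtain r3 u where r3: "strict_mono r3" "(\<lambda>n. f (xs (r1 (r2 (r3 n))))) \<longlonglongrightarrow> u"
        by (rule totally_bounded_convergent_subseq[where s = "\<lambda>n. f (xs (r1 (r2 n)))", OF cball *])
      have *: "f (ys (r1 (r2 (r3 n)))) \<in> f ` cball zM B2" for n
        using bounded(2)[of "r3 n"] by (simp add: dist_commute)
      obtain r4 v where r4: "strict_mono r4" "(\<lambda>n. f (ys (r1 (r2 (r3 (r4 n)))))) \<longlonglongrightarrow> v"
        by (rule totally_bounded_convergent_subseq[where s = "\<lambda>n. f (ys (r1 (r2 (r3 n))))", OF cball *])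
      show thesis
      proof (rule that)
        show "strict_mono (\<lambda>n. r1 (r2 (r3 (r4 n))))"
          using r1(1) bounded(1) r3(1) r4(1) by (auto simp: strict_mono_def)
        show "(\<lambda>n. f (xs (r1 (r2 (r3 (r4 n)))))) \<longlonglongrightarrow> u"
          using LIMSEQ_subseq_LIMSEQ[OF r3(2) r4(1)] by (simp add: o_def)
      qed (rule r4(2))
    next
      case unbounded
      then show thesis
        using no_steep_mixed_pairs[of "\<lambda>n. xs (r1 n)" B1 "\<lambda>n. ys (r1 n)" c] r1 \<open>c > 0\<close> steep by blast
    qed
  next
    case unbounded
    note inf = this
    show thesis
    proof (cases "\<lambda>n. dist (ys n) zM" rule: bounded_or_unbounded_subseq)
      case (bounded r B)
      have "filterlim (\<lambda>n. dist (xs (r n)) zM) at_top sequentially"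
        using filterlim_compose[OF inf filterlim_subseq[OF bounded(1)]] .
      moreover have "c * dist (ys (r n)) (xs (r n)) \<le> dist (f (ys (r n))) (f (xs (r n)))" for n
        using steep[of "r n"] by (simp add: dist_commute)
      ultimately show thesis
        using no_steep_mixed_pairs[of "\<lambda>n. ys (r n)" B "\<lambda>n. xs (r n)" c] bounded(2) \<open>c > 0\<close> by blast
    next
      case unbounded
      show thesis
        by (rule steep_at_infinity[where xs = xs and ys = ys, OF ne inf unbounded \<open>c > 0\<close> steep]) (rule that)
    qed
  qed
qed

text \<open>A nonzero liminf yields steep pairs whose images converge. Local flatness then bounds
  d(x,y) away from 0, and steepness bounds it above by the bounded image distances, so a further
  subsequence has a positive limit \<open>t\<close>.\<close>

lemma pairs_subseq:
  fixes xs ys :: "nat \<Rightarrow> 'a"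
  assumes ne: "\<And>n. xs n \<noteq> ys n"
  obtains (flat) r where "strict_mono r"
      "(\<lambda>n. dist (f (xs (r n))) (f (ys (r n))) / dist (xs (r n)) (ys (r n))) \<longlonglongrightarrow> 0"
  | (steep) r u v t where "strict_mono r" "(\<lambda>n. f (xs (r n))) \<longlonglongrightarrow> u" "(\<lambda>n. f (ys (r n))) \<longlonglongrightarrow> v"
      "(\<lambda>n. dist (xs (r n)) (ys (r n))) \<longlonglongrightarrow> t" "t > 0"
proof (cases "liminf (\<lambda>n. ereal (dist (f (xs n)) (f (ys n)) / dist (xs n) (ys n))) = 0")
  case True
  then show thesis
    by (rule liminf_ereal_eq_0_subseq) (rule flat)
next
  case False
  then obtain c where "c > 0" "\<forall>\<^sub>F n in sequentially. c \<le> dist (f (xs n)) (f (ys n)) / dist (xs n) (ys n)"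
    using liminf_ereal_nonneg_neq_0[of "\<lambda>n. dist (f (xs n)) (f (ys n)) / dist (xs n) (ys n)"] by auto
  then obtain N where N: "\<And>n. n \<ge> N \<Longrightarrow> c \<le> dist (f (xs n)) (f (ys n)) / dist (xs n) (ys n)"
    by (auto simp: eventually_sequentially)
  have st: "c * dist (xs (n + N)) (ys (n + N)) \<le> dist (f (xs (n + N))) (f (ys (n + N)))" for n
    using N[of "n + N"] ne[of "n + N"] by (simp add: pos_le_divide_eq)
  obtain r u v where r: "strict_mono r" and u: "(\<lambda>n. f (xs (r n + N))) \<longlonglongrightarrow> u"
    and v: "(\<lambda>n. f (ys (r n + N))) \<longlonglongrightarrow> v"
    by (rule steep_pairs_images_converge[where xs = "\<lambda>n. xs (n + N)" and ys = "\<lambda>n. ys (n + N)", OF ne \<open>c > 0\<close> st])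
  define d where "d n = dist (xs (r n + N)) (ys (r n + N))" for n
  have d_pos: "d n > 0" for n using ne by (simp add: d_def)
  obtain \<delta> where "\<delta> > 0" and \<delta>: "\<And>x y. 0 < dist x y \<Longrightarrow> dist x y \<le> \<delta> \<Longrightarrow> dist (f x) (f y) \<le> c / 2 * dist x y"
    using locally_flat[of "c / 2"] \<open>c > 0\<close> by auto
  have lower: "\<delta> \<le> d n" for n
  proof (rule ccontr)
    assume "\<not> \<delta> \<le> d n"
    then have "dist (f (xs (r n + N))) (f (ys (r n + N))) \<le> c / 2 * d n"
      using \<delta>[of "xs (r n + N)" "ys (r n + N)"] d_pos[of n] by (simp add: d_def)
    then have "c * d n \<le> c / 2 * d n" using st[of "r n"] by (simp add: d_def)
    moreover have "c * d n > 0" using \<open>c > 0\<close> d_pos by simp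
    ultimately show False by simp
  qed
  have "Bseq (\<lambda>n. dist (f (xs (r n + N))) (f (ys (r n + N))))"
    by (rule convergent_imp_Bseq) (auto intro!: convergentI tendsto_dist u v)
  then obtain D where D: "\<And>n. dist (f (xs (r n + N))) (f (ys (r n + N))) \<le> D"
    by (auto simp: Bseq_def)
  have "d n \<le> D / c" for n
    using order_trans[OF st D] \<open>c > 0\<close> by (simp add: d_def field_simps)
  then have "bounded (range d)"
    using d_pos by (intro boundedI[of _ "D / c"]) (auto simp: less_imp_le)
  then obtain t r' where r': "strict_mono r'" and t: "(d \<circ> r') \<longlonglongrightarrow> t"
    using bounded_imp_convergent_subsequence by blast
  have "\<delta> \<le> t"
    using lower by (intro tendsto_lowerbound[OF t]) (auto intro: always_eventually)
  show thesis
  proof (rule steep)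
    show "strict_mono (\<lambda>n. r (r' n) + N)"
      using r r' by (auto simp: strict_mono_def)
    show "(\<lambda>n. f (xs (r (r' n) + N))) \<longlonglongrightarrow> u" "(\<lambda>n. f (ys (r (r' n) + N))) \<longlonglongrightarrow> v"
      using LIMSEQ_subseq_LIMSEQ[OF u r'] LIMSEQ_subseq_LIMSEQ[OF v r'] by (simp_all add: o_def)
    show "(\<lambda>n. dist (xs (r (r' n) + N)) (ys (r (r' n) + N))) \<longlonglongrightarrow> t"
      using t by (simp add: o_def d_def)
    show "t > 0" using \<open>\<delta> \<le> t\<close> \<open>\<delta> > 0\<close> by simp
  qed
qed

definition slope :: "('b \<Rightarrow> 'k::real_normed_field) \<Rightarrow> 'a \<Rightarrow> 'a \<Rightarrow> 'k" where
  "slope g x y = (g (f x) - g (f y)) / of_real (dist x y)"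

lemma norm_slope_le:
  assumes "g \<in> lip0_ball zN" "x \<noteq> y"
  shows "norm (slope g x y) \<le> dist (f x) (f y) / dist x y" "norm (slope g x y) \<le> C"
proof -
  show *: "norm (slope g x y) \<le> dist (f x) (f y) / dist x y"
    using lip0_ballD(2)[OF assms(1)] by (simp add: slope_def norm_divide divide_right_mono)
  also have "\<dots> \<le> C" using lip assms(2) by (simp add: divide_le_eq)
  finally show "norm (slope g x y) \<le> C" .
qed

lemma slopes_uniformly_convergent_subseq:
  fixes xs ys :: "nat \<Rightarrow> 'a"
  assumes ne: "\<And>n. xs n \<noteq> ys n"
  obtains r e and l :: "('b \<Rightarrow> 'k::real_normed_field) \<Rightarrow> 'k" where "strict_mono r" "e \<longlonglongrightarrow> 0"
    "\<And>n g. g \<in> lip0_ball zN \<Longrightarrow> norm (slope g (xs (r n)) (ys (r n)) - l g) \<le> e n"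
proof (rule pairs_subseq[where xs = xs and ys = ys, OF ne], goal_cases)
  case (1 r)
  then show thesis
    using norm_slope_le(1)[OF _ ne] by (intro that[of r _ "\<lambda>g. 0"]) auto
next
  case steep: (2 r u v t)
  define a b d where "a n = f (xs (r n))" and "b n = f (ys (r n))" and "d n = dist (xs (r n)) (ys (r n))" for n
  define e where "e n = (dist (a n) u + dist (b n) v) / d n + dist u v * \<bar>1 / d n - 1 / t\<bar>" for n
  have ab: "a \<longlonglongrightarrow> u" "b \<longlonglongrightarrow> v" "d \<longlonglongrightarrow> t"
    using steep by (simp_all add: a_def[abs_def] b_def[abs_def] d_def[abs_def])
  have "e \<longlonglongrightarrow> (dist u u + dist v v) / t + dist u v * \<bar>1 / t - 1 / t\<bar>"
    unfolding e_def using \<open>t > 0\<close> by (intro tendsto_intros ab) auto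
  then have e: "e \<longlonglongrightarrow> 0" by simp
  show thesis
  proof (rule that[OF steep(2) e, of "\<lambda>g. (g u - g v) / of_real t"])
    fix n and g :: "'b \<Rightarrow> 'k" assume g: "g \<in> lip0_ball zN"
    have d_pos: "d n > 0" using ne by (simp add: d_def)
    have "slope g (xs (r n)) (ys (r n)) - (g u - g v) / of_real t =
        ((g (a n) - g u) - (g (b n) - g v)) / of_real (d n) + (g u - g v) * of_real (1 / d n - 1 / t)"
      by (simp add: slope_def a_def b_def d_def diff_divide_distrib add_divide_distrib algebra_simps)
    also have "norm \<dots> \<le> norm (((g (a n) - g u) - (g (b n) - g v)) / of_real (d n)) +
        norm ((g u - g v) * of_real (1 / d n - 1 / t))"
      by (rule norm_triangle_ineq)
    also have "\<dots> = norm ((g (a n) - g u) - (g (b n) - g v)) / d n + norm (g u - g v) * \<bar>1 / d n - 1 / t\<bar>"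
      using d_pos by (simp only: norm_divide norm_mult norm_of_real abs_of_pos)
    also have "\<dots> \<le> e n"
      unfolding e_def
      using d_pos order_trans[OF norm_triangle_ineq4 add_mono[OF lip0_ballD(2)[OF g] lip0_ballD(2)[OF g]]]
      by (intro add_mono divide_right_mono mult_right_mono lip0_ballD(2)[OF g]) auto
    finally show "norm (slope g (xs (r n)) (ys (r n)) - (g u - g v) / of_real t) \<le> e n" .
  qed
qed

lemma finite_net_of_slopes:
  assumes "e > 0"
  obtains T where "finite T" "\<And>x y. (x, y) \<in> T \<Longrightarrow> x \<noteq> y"
    "\<And>x y. x \<noteq> y \<Longrightarrow> \<exists>(x', y')\<in>T. \<forall>g :: 'b \<Rightarrow> 'k::real_normed_field. g \<in> lip0_ball zN \<longrightarrow>
        norm (slope g x' y' - slope g x y) \<le> e"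
proof -
  define R where "R = (\<lambda>p q. \<not> (\<forall>g :: 'b \<Rightarrow> 'k. g \<in> lip0_ball zN \<longrightarrow>
        norm (slope g (fst p) (snd p) - slope g (fst q) (snd q)) \<le> e))"
  have "\<exists>T. finite T \<and> T \<subseteq> {p. fst p \<noteq> snd p} \<and> (\<forall>q\<in>{p. fst p \<noteq> snd p}. \<exists>p\<in>T. \<not> R p q)"
  proof (rule ccontr)
    assume "\<not> ?thesis"
    then obtain s :: "nat \<Rightarrow> 'a \<times> 'a" where s: "\<And>n. s n \<in> {p. fst p \<noteq> snd p}"
      and sep: "\<And>m n. m < n \<Longrightarrow> R (s m) (s n)"
      by (rule finite_net_or_separated_sequence) blast
    have ne: "fst (s n) \<noteq> snd (s n)" for n using s by simp
    obtain r \<eta> and l :: "('b \<Rightarrow> 'k) \<Rightarrow> 'k" where r: "strict_mono r" and \<eta>: "\<eta> \<longlonglongrightarrow> 0"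
      and l: "\<And>n g. g \<in> lip0_ball zN \<Longrightarrow> norm (slope g (fst (s (r n))) (snd (s (r n))) - l g) \<le> \<eta> n"
      by (rule slopes_uniformly_convergent_subseq[where xs = "\<lambda>n. fst (s n)" and ys = "\<lambda>n. snd (s n)", OF ne]) blast
    have "\<forall>\<^sub>F n in sequentially. \<eta> n < e / 2"
      using order_tendstoD(2)[OF \<eta> half_gt_zero[OF assms]] .
    then obtain N where N: "\<And>n. n \<ge> N \<Longrightarrow> \<eta> n < e / 2"
      by (auto simp: eventually_sequentially)
    have "norm (slope g (fst (s (r N))) (snd (s (r N))) - slope g (fst (s (r (Suc N)))) (snd (s (r (Suc N))))) \<le> e"
      if "g \<in> lip0_ball zN" for g :: "'b \<Rightarrow> 'k"
      using norm_diff_triangle_le[OF l[OF that, of N] l[OF that, of "Suc N", unfolded norm_minus_commute[of _ "l g"]]]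
        N[of N] N[of "Suc N"] by simp
    then have "\<not> R (s (r N)) (s (r (Suc N)))" by (simp add: R_def)
    moreover have "r N < r (Suc N)" using r by (simp add: strict_mono_Suc_iff)
    ultimately show False using sep by blast
  qed
  then obtain T where T: "finite T" "T \<subseteq> {p. fst p \<noteq> snd p}" "\<forall>q\<in>{p. fst p \<noteq> snd p}. \<exists>p\<in>T. \<not> R p q"
    by (elim exE conjE)
  show thesis
  proof (rule that[OF T(1)])
    show "x \<noteq> y" if "(x, y) \<in> T" for x y
      using T(2) that by force
    show "\<exists>(x', y')\<in>T. \<forall>g :: 'b \<Rightarrow> 'k::real_normed_field. g \<in> lip0_ball zN \<longrightarrow>
        norm (slope g x' y' - slope g x y) \<le> e" if "x \<noteq> y" for x y
      using T(3)[rule_format, of "(x, y)"] that by (auto simp: R_def split_beta)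
  qed
qed

lemma finite_net_of_ball:
  assumes "e > 0"
  obtains G :: "('b \<Rightarrow> 'k::{real_normed_field,heine_borel}) set" where "finite G" "G \<subseteq> lip0_ball zN"
    "\<And>g. g \<in> lip0_ball zN \<Longrightarrow> \<exists>h\<in>G. \<forall>x y. x \<noteq> y \<longrightarrow> norm (slope h x y - slope g x y) \<le> e"
proof -
  define R where "R = (\<lambda>h g :: 'b \<Rightarrow> 'k. \<not> (\<forall>x y. x \<noteq> y \<longrightarrow> norm (slope h x y - slope g x y) \<le> e))"
  have "\<exists>G. finite G \<and> G \<subseteq> lip0_ball zN \<and> (\<forall>g\<in>lip0_ball zN. \<exists>h\<in>G. \<not> R h g)"
  proof (rule ccontr)
    assume "\<not> ?thesis"
    then obtain g :: "nat \<Rightarrow> 'b \<Rightarrow> 'k" where g: "\<And>n. g n \<in> lip0_ball zN"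
      and sep: "\<And>m n. m < n \<Longrightarrow> R (g m) (g n)"
      by (rule finite_net_or_separated_sequence) blast
    obtain T where T: "finite T" "\<And>x y. (x, y) \<in> T \<Longrightarrow> x \<noteq> y"
      and net: "\<And>x y. x \<noteq> y \<Longrightarrow> \<exists>(x', y')\<in>T. \<forall>g :: 'b \<Rightarrow> 'k. g \<in> lip0_ball zN \<longrightarrow>
        norm (slope g x' y' - slope g x y) \<le> e / 3"
      using finite_net_of_slopes[of "e / 3"] assms by auto
    have bd: "norm (slope (g n) (fst p) (snd p)) \<le> C" if "p \<in> T" for n p
      using norm_slope_le(2)[OF g] T(2)[of "fst p" "snd p"] that by simp
    obtain k where k: "strict_mono (k :: nat \<Rightarrow> nat)"
      and lim: "\<And>p. p \<in> T \<Longrightarrow> \<exists>l. (\<lambda>n. slope (g (k n)) (fst p) (snd p)) \<longlonglongrightarrow> l"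
      by (rule function_convergent_subsequence[where f = "\<lambda>n p. slope (g n) (fst p) (snd p)",
            OF countable_finite[OF T(1)] bd]) (assumption, rule that, assumption, simp)
    have "\<forall>p\<in>T. \<forall>\<^sub>F n in sequentially. norm (slope (g (k n)) (fst p) (snd p) - slope (g (k (Suc n))) (fst p) (snd p)) < e / 3"
    proof
      fix p assume "p \<in> T"
      then obtain l where l: "(\<lambda>n. slope (g (k n)) (fst p) (snd p)) \<longlonglongrightarrow> l"
        using lim by blast
      have "(\<lambda>n. norm (slope (g (k n)) (fst p) (snd p) - slope (g (k (Suc n))) (fst p) (snd p))) \<longlonglongrightarrow> norm (l - l)"
        by (intro tendsto_intros l LIMSEQ_Suc[OF l])
      then show "\<forall>\<^sub>F n in sequentially. norm (slope (g (k n)) (fst p) (snd p) - slope (g (k (Suc n))) (fst p) (snd p)) < e / 3"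
        by (rule order_tendstoD) (use assms in simp)
    qed
    then have "\<forall>\<^sub>F n in sequentially. \<forall>p\<in>T. norm (slope (g (k n)) (fst p) (snd p) - slope (g (k (Suc n))) (fst p) (snd p)) < e / 3"
      by (rule eventually_ball_finite[OF T(1)])
    then obtain n where n: "\<And>p. p \<in> T \<Longrightarrow> norm (slope (g (k n)) (fst p) (snd p) - slope (g (k (Suc n))) (fst p) (snd p)) < e / 3"
      by (auto simp: eventually_sequentially)
    have "norm (slope (g (k n)) x y - slope (g (k (Suc n))) x y) \<le> e" if "x \<noteq> y" for x y
    proof -
      obtain x' y' where p: "(x', y') \<in> T" "\<And>g :: 'b \<Rightarrow> 'k. g \<in> lip0_ball zN \<Longrightarrow>
          norm (slope g x' y' - slope g x y) \<le> e / 3"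
        using net[OF \<open>x \<noteq> y\<close>] by blast
      have "norm (slope (g (k n)) x y - slope (g (k (Suc n))) x' y') \<le> e / 3 + e / 3"
        using p(2)[OF g, of "k n"] n[OF p(1)] 
        by (intro norm_diff_triangle_le[of _ "slope (g (k n)) x' y'"]) (auto simp: norm_minus_commute)
      from norm_diff_triangle_le[OF this p(2)[OF g]] show ?thesis by simp
    qed
    then have "\<not> R (g (k n)) (g (k (Suc n)))" unfolding R_def by blast
    moreover have "k n < k (Suc n)" using k by (simp add: strict_mono_Suc_iff)
    ultimately show False using sep by blast
  qed
  then obtain G where "finite G" "G \<subseteq> lip0_ball zN" "\<forall>g\<in>lip0_ball zN. \<exists>h\<in>G. \<not> R h g"
    by (elim exE conjE)
  then show thesis by (intro that[of G]) (simp_all only: R_def not_not)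
qed

lemma lipschitz: "C-lipschitz_on UNIV f"
  using lip C_pos by (auto intro!: lipschitz_onI)

lemma lip0_ball_compose_dist:
  assumes "g \<in> lip0_ball zN"
  shows "norm (g (f x) - g (f y)) \<le> C * dist x y"
  using order_trans[OF lip0_ballD(2)[OF assms] lip] .

lemma free_lift_approx:
  assumes \<Phi>: "\<Phi> \<in> free_space zM" and "e > 0"
  shows "\<exists>P a. finite P \<and> (\<forall>g :: 'b \<Rightarrow> 'k::real_normed_field. g \<in> lip0_ball zN \<longrightarrow>
      norm (free_lift zN f \<Phi> g - (\<Sum>p\<in>P. a p * evalf zN p g)) \<le> e)"
proof -
  have dual: "\<Phi> \<in> lip0_dual zM"
    and app: "\<forall>\<epsilon>>0. \<exists>P a. finite P \<and> dual_norm zM (\<lambda>g. \<Phi> g - (\<Sum>p\<in>P. a p * evalf zM p g)) < \<epsilon>"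
    using \<Phi> unfolding free_space_def mem_Collect_eq by (rule conjunct1, rule conjunct2)
  have "e / C > 0" using \<open>e > 0\<close> C_pos by simp
  obtain P a where P: "finite P" and small: "dual_norm zM (\<lambda>g. \<Phi> g - (\<Sum>p\<in>P. a p * evalf zM p g)) < e / C"
    using app[rule_format, OF \<open>e / C > 0\<close>] by (elim exE conjE)
  define b where "b q = (\<Sum>p\<in>{p \<in> P. f p = q}. a p)" for q
  have "norm (free_lift zN f \<Phi> g - (\<Sum>q\<in>f ` P. b q * evalf zN q g)) \<le> e"
    if g: "g \<in> lip0_ball zN" for g :: "'b \<Rightarrow> 'k"
  proof -
    note gl = lip0_ballD(3)[OF g]
    have gf: "g \<circ> f \<in> lip0 zM" using lip0_compose[OF lipschitz base gl] .
    have "(\<Sum>q\<in>f ` P. b q * evalf zN q g) = (\<Sum>q\<in>f ` P. \<Sum>p\<in>{p \<in> P. f p = q}. a p * g (f p))"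
      using gl by (auto simp: b_def sum_distrib_right evalf_def intro!: sum.cong)
    also have "\<dots> = (\<Sum>p\<in>P. a p * g (f p))"
      by (rule sum.image_gen[OF P, symmetric])
    also have "\<dots> = (\<Sum>p\<in>P. a p * evalf zM p (g \<circ> f))"
      using gf by (simp add: evalf_def)
    finally have "norm (free_lift zN f \<Phi> g - (\<Sum>q\<in>f ` P. b q * evalf zN q g)) =
        norm (\<Phi> (g \<circ> f) - (\<Sum>p\<in>P. a p * evalf zM p (g \<circ> f)))"
      using gl by (simp add: free_lift_def)
    also have "\<dots> \<le> C * dual_norm zM (\<lambda>g. \<Phi> g - (\<Sum>p\<in>P. a p * evalf zM p g))"
    proof (rule norm_le_lipschitz_mult_dual_norm)
      show "ball_bounded zM (\<lambda>g. \<Phi> g - (\<Sum>p\<in>P. a p * evalf zM p g))"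
        by (intro ball_bounded_diff ball_bounded_evalf_sum lip0_dual_ball_bounded dual)
      show "\<Phi> (\<lambda>x. c * (g \<circ> f) x) - (\<Sum>p\<in>P. a p * evalf zM p (\<lambda>x. c * (g \<circ> f) x)) =
          c * (\<Phi> (g \<circ> f) - (\<Sum>p\<in>P. a p * evalf zM p (g \<circ> f)))" for c
        unfolding lip0_dualD(1)[OF dual gf]
        using lip0_mult[OF gf] gf by (simp add: evalf_def right_diff_distrib sum_distrib_left mult.left_commute)
    qed (use lip0_ball_compose_dist[OF g] C_pos gf in \<open>auto simp: lip0_def\<close>)
    also have "\<dots> \<le> e"
      using small C_pos by (simp add: field_simps)
    finally show ?thesis .
  qed
  then show ?thesis using P by (intro exI[of _ "f ` P"] exI[of _ b]) simp
qed

lemma norm_dual_compose_le: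
  fixes \<Phi> :: "('a \<Rightarrow> 'k::real_normed_field) \<Rightarrow> 'k"
  assumes \<Phi>: "\<Phi> \<in> lip0_dual zM" and g: "g \<in> lip0_ball zN"
  shows "norm (\<Phi> (g \<circ> f)) \<le> C * dual_norm zM \<Phi>"
proof (rule norm_le_lipschitz_mult_dual_norm[OF lip0_dual_ball_bounded[OF \<Phi>] lip0_dualD(1)[OF \<Phi>]])
  show "g \<circ> f \<in> lip0 zM" using lip0_compose[OF lipschitz base lip0_ballD(3)[OF g]] .
qed (use lip0_ball_compose_dist[OF g] C_pos lip0_ballD(1)[OF g] base in auto)

lemma dual_diff_le:
  fixes \<Phi> :: "('a \<Rightarrow> 'k::real_normed_field) \<Rightarrow> 'k"
  assumes \<Phi>: "\<Phi> \<in> lip0_dual zM" "dual_norm zM \<Phi> \<le> 1"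
    and g: "g \<in> lip0_ball zN" and h: "h \<in> lip0_ball zN" and "e > 0"
    and close: "\<And>x y. x \<noteq> y \<Longrightarrow> norm (slope h x y - slope g x y) \<le> e"
  shows "norm (\<Phi> (h \<circ> f) - \<Phi> (g \<circ> f)) \<le> e"
proof -
  have gf: "g \<circ> f \<in> lip0 zM" and hf: "h \<circ> f \<in> lip0 zM"
    using lip0_compose[OF lipschitz base] lip0_ballD(3) g h by blast+
  define q where "q = (\<lambda>x. (h \<circ> f) x + (- 1) * (g \<circ> f) x)"
  have qL: "norm (q x - q y) \<le> e * dist x y" for x y
  proof (cases "x = y")
    case False
    have "slope h x y - slope g x y = (q x - q y) / of_real (dist x y)"
      by (simp add: slope_def q_def diff_divide_distrib)
    then show ?thesis
      using close[OF False] False by (simp add: norm_divide divide_le_eq)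
  qed simp
  have q0: "q zM = 0"
    using gf hf by (simp add: q_def lip0_def)
  have ql: "q \<in> lip0 zM" using qL q0 by (auto simp: lip0_def)
  have "\<Phi> q = \<Phi> (h \<circ> f) + (- 1) * \<Phi> (g \<circ> f)"
    unfolding q_def lip0_dualD(2)[OF \<Phi>(1) hf lip0_mult[OF gf]] lip0_dualD(1)[OF \<Phi>(1) gf] ..
  then have "norm (\<Phi> (h \<circ> f) - \<Phi> (g \<circ> f)) \<le> e * dual_norm zM \<Phi>"
    using norm_le_lipschitz_mult_dual_norm[OF lip0_dual_ball_bounded[OF \<Phi>(1)] lip0_dualD(1)[OF \<Phi>(1) ql] q0 qL \<open>e > 0\<close>]
    by simp
  also have "\<dots> \<le> e * 1"
    using \<Phi>(2) \<open>e > 0\<close> by (intro mult_left_mono) auto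
  finally show ?thesis by simp
qed

lemma dual_sequence_uniformly_convergent_subseq:
  fixes s :: "nat \<Rightarrow> ('a \<Rightarrow> 'k::{real_normed_field,heine_borel}) \<Rightarrow> 'k"
  assumes s: "\<And>n. s n \<in> lip0_dual zM" "\<And>n. dual_norm zM (s n) \<le> 1"
  obtains k l where "strict_mono k"
    "uniform_limit (lip0_ball zN) (\<lambda>n g. s (k n) (g \<circ> f)) l sequentially"
proof -
  have "\<exists>G. finite G \<and> G \<subseteq> lip0_ball zN \<and> (\<forall>g \<in> lip0_ball zN. \<exists>h\<in>G. \<forall>x y. x \<noteq> y \<longrightarrow>
      norm (slope (h :: 'b \<Rightarrow> 'k) x y - slope g x y) \<le> inverse (real (Suc j)))" for j
    by (rule finite_net_of_ball[of "inverse (real (Suc j))"]) (simp, blast)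
  then obtain G where G: "\<And>j. finite (G j)" "\<And>j. G j \<subseteq> lip0_ball zN"
    and net: "\<And>j g. g \<in> lip0_ball zN \<Longrightarrow> \<exists>h\<in>G j. \<forall>x y. x \<noteq> y \<longrightarrow>
      norm (slope (h :: 'b \<Rightarrow> 'k) x y - slope g x y) \<le> inverse (real (Suc j))"
    by metis
  have bd: "norm (s n (g \<circ> f)) \<le> C" if g: "g \<in> lip0_ball zN" for n g
  proof -
    have "norm (s n (g \<circ> f)) \<le> C * dual_norm zM (s n)"
      by (rule norm_dual_compose_le[OF s(1) g])
    also have "\<dots> \<le> C * 1" using s(2) C_pos by (intro mult_left_mono) auto
    finally show ?thesis by simp
  qed
  have cG: "countable (\<Union>j. G j)"
    using G(1) by (intro countable_UN) (auto intro: countable_finite)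
  have bdG: "norm (s n (g \<circ> f)) \<le> C" if "g \<in> (\<Union>j. G j)" for n g
    using bd that G(2) by blast
  obtain k where k: "strict_mono (k :: nat \<Rightarrow> nat)"
    and lim: "\<And>g. g \<in> (\<Union>j. G j) \<Longrightarrow> \<exists>l. (\<lambda>n. s (k n) (g \<circ> f)) \<longlonglongrightarrow> l"
    by (rule function_convergent_subsequence[where f = "\<lambda>n g. s n (g \<circ> f)", OF cG bdG])
      (assumption, rule that, assumption, simp)
  have "uniformly_Cauchy_on (lip0_ball zN) (\<lambda>n g. s (k n) (g \<circ> f))"
    unfolding uniformly_Cauchy_on_def
  proof (intro allI impI)
    fix e :: real assume "e > 0"
    then obtain j where j: "inverse (real (Suc j)) < e / 4"
      using reals_Archimedean[of "e / 4"] by auto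
    have "\<forall>h\<in>G j. \<exists>M. \<forall>m\<ge>M. \<forall>n\<ge>M. dist (s (k m) (h \<circ> f)) (s (k n) (h \<circ> f)) < e / 4"
    proof
      fix h assume "h \<in> G j"
      then have "Cauchy (\<lambda>n. s (k n) (h \<circ> f))"
        using lim[of h] by (auto intro: LIMSEQ_imp_Cauchy)
      then show "\<exists>M. \<forall>m\<ge>M. \<forall>n\<ge>M. dist (s (k m) (h \<circ> f)) (s (k n) (h \<circ> f)) < e / 4"
        using \<open>e > 0\<close> unfolding Cauchy_def by (metis divide_pos_pos zero_less_numeral)
    qed
    then obtain M where M: "\<And>h m n. h \<in> G j \<Longrightarrow> m \<ge> M h \<Longrightarrow> n \<ge> M h \<Longrightarrow>
        dist (s (k m) (h \<circ> f)) (s (k n) (h \<circ> f)) < e / 4"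
      by metis
    define N where "N = Max (insert 0 (M ` G j))"
    have N: "M h \<le> N" if "h \<in> G j" for h
      using that G(1)[of j] by (auto simp: N_def)
    show "\<exists>M. \<forall>g\<in>lip0_ball zN. \<forall>m\<ge>M. \<forall>n\<ge>M. dist (s (k m) (g \<circ> f)) (s (k n) (g \<circ> f)) < e"
    proof (intro exI ballI allI impI)
      fix g :: "'b \<Rightarrow> 'k" and m n assume g: "g \<in> lip0_ball zN" and mn: "m \<ge> N" "n \<ge> N"
      obtain h where h: "h \<in> G j" and close: "\<forall>x y. x \<noteq> y \<longrightarrow>
          norm (slope h x y - slope g x y) \<le> inverse (real (Suc j))"
        using net[OF g, of j] by (elim bexE)
      have *: "dist (s i (h \<circ> f)) (s i (g \<circ> f)) < e / 4" for i
      proof -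
        have "norm (s i (h \<circ> f) - s i (g \<circ> f)) \<le> inverse (real (Suc j))"
          using h G(2) g close by (intro dual_diff_le s) auto
        then show ?thesis using j by (simp add: dist_norm)
      qed
      have "dist (s (k m) (h \<circ> f)) (s (k n) (h \<circ> f)) < e / 4"
        using M[OF h] N[OF h] mn by simp
      moreover have "dist (s (k m) (g \<circ> f)) (s (k n) (g \<circ> f)) \<le> dist (s (k m) (h \<circ> f)) (s (k m) (g \<circ> f)) +
          dist (s (k m) (h \<circ> f)) (s (k n) (h \<circ> f)) + dist (s (k n) (h \<circ> f)) (s (k n) (g \<circ> f))"
        by metric
      ultimately show "dist (s (k m) (g \<circ> f)) (s (k n) (g \<circ> f)) < e"
        using *[of "k m"] *[of "k n"] \<open>e > 0\<close> by linarith
    qed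
  qed
  then have "uniformly_convergent_on (lip0_ball zN) (\<lambda>n g. s (k n) (g \<circ> f))"
    by (rule Cauchy_uniformly_convergent)
  then show thesis using that[OF k] by (auto simp: uniformly_convergent_on_def)
qed

lemma free_lift_compact: "free_lift_compact TYPE('k::{real_normed_field,heine_borel}) zM zN f"
  unfolding free_lift_compact_def
proof (intro allI impI)
  fix s :: "nat \<Rightarrow> ('a \<Rightarrow> 'k) \<Rightarrow> 'k"
  assume s: "\<forall>n. s n \<in> free_space zM \<and> dual_norm zM (s n) \<le> 1"
  then have dual: "s n \<in> lip0_dual zM" for n
    by (simp add: free_space_def)
  obtain k l where k: "strict_mono k"
    and unif: "uniform_limit (lip0_ball zN) (\<lambda>n g. s (k n) (g \<circ> f)) l sequentially"
    using dual_sequence_uniformly_convergent_subseq[of s] dual s by blast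
  have gf: "g \<circ> f \<in> lip0 zM" if "g \<in> lip0 zN" for g :: "'b \<Rightarrow> 'k"
    using lip0_compose[OF lipschitz base that] .
  note add = lip0_dualD(2)[OF dual] and hom = lip0_dualD(1)[OF dual]
  define \<Psi> where "\<Psi> = (\<lambda>g. if g \<in> lip0 zN then lim (\<lambda>n. s (k n) (g \<circ> f)) else 0)"
  have lim: "(\<lambda>n. s (k n) (g \<circ> f)) \<longlonglongrightarrow> \<Psi> g" if g: "g \<in> lip0 zN" for g :: "'b \<Rightarrow> 'k"
  proof -
    obtain D where g0: "g zN = 0" and D: "\<And>x y. norm (g x - g y) \<le> D * dist x y"
      using g by (auto simp: lip0_def)
    define L where "L = max D 1"
    have "L > 0" by (simp add: L_def)
    have DL: "norm (g x - g y) \<le> L * dist x y" for x y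
      by (rule order_trans[OF D]) (auto simp: L_def intro: mult_right_mono)
    define h where "h = (\<lambda>x. of_real (1 / L) * g x)"
    have h: "h \<in> lip0_ball zN"
      unfolding h_def using g0 DL \<open>L > 0\<close> by (rule lip0_normalise)
    have gh: "g \<circ> f = (\<lambda>x. of_real L * (h \<circ> f) x)"
      using \<open>L > 0\<close> by (auto simp: h_def)
    have "(\<lambda>n. of_real L * s (k n) (h \<circ> f)) \<longlonglongrightarrow> of_real L * l h"
      by (intro tendsto_intros tendsto_uniform_limitI[OF unif h])
    then have "convergent (\<lambda>n. s (k n) (g \<circ> f))"
      unfolding gh hom[OF gf[OF lip0_ballD(3)[OF h]]] by (rule convergentI)
    then show ?thesis using g by (simp add: \<Psi>_def convergent_LIMSEQ_iff)
  qed
  have \<Psi>l: "\<Psi> g = l g" if "g \<in> lip0_ball zN" for g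
    using LIMSEQ_unique[OF lim[OF lip0_ballD(3)[OF that]] tendsto_uniform_limitI[OF unif that]] .
  have close: "\<forall>\<^sub>F n in sequentially. \<forall>g\<in>lip0_ball zN. norm (free_lift zN f (s (k n)) g - \<Psi> g) < e"
    if "e > 0" for e
    using uniform_limitD[OF unif that]
    by (auto simp: free_lift_def \<Psi>l lip0_ballD(3) dist_norm elim!: eventually_mono)
  have lift_dual_bdd: "\<exists>D. \<forall>g\<in>lip0_ball zN. norm (\<Psi> g) \<le> D"
  proof -
    obtain n where n: "\<forall>g\<in>lip0_ball zN. norm (free_lift zN f (s n) g - \<Psi> g) < 1"
      using close[of 1] by (auto simp: eventually_sequentially)
    have "norm (\<Psi> g) \<le> C * dual_norm zM (s n) + 1" if g: "g \<in> lip0_ball zN" for g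
    proof -
      have "norm (s n (g \<circ> f)) \<le> C * dual_norm zM (s n)"
        by (rule norm_dual_compose_le[OF dual g])
      moreover have "norm (s n (g \<circ> f) - \<Psi> g) < 1"
        using n g lip0_ballD(3)[OF g] by (auto simp: free_lift_def)
      ultimately show ?thesis
        using norm_triangle_sub[of "\<Psi> g" "s n (g \<circ> f)"] by (simp add: norm_minus_commute)
    qed
    then show ?thesis by blast
  qed
  have \<Psi>_dual: "\<Psi> \<in> lip0_dual zN"
    unfolding lip0_dual_def
  proof (intro CollectI conjI allI impI lift_dual_bdd)
    fix g h :: "'b \<Rightarrow> 'k" assume g: "g \<in> lip0 zN" and h: "h \<in> lip0 zN"
    from lim[OF lip0_add[OF g h]] have "(\<lambda>n. s (k n) (g \<circ> f) + s (k n) (h \<circ> f)) \<longlonglongrightarrow> \<Psi> (\<lambda>x. g x + h x)"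
      using add[OF gf[OF g] gf[OF h]] by (simp add: o_def)
    then show "\<Psi> (\<lambda>x. g x + h x) = \<Psi> g + \<Psi> h"
      using LIMSEQ_unique tendsto_add[OF lim[OF g] lim[OF h]] by blast
  next
    fix c and g :: "'b \<Rightarrow> 'k" assume g: "g \<in> lip0 zN"
    from lim[OF lip0_mult[OF g]] have "(\<lambda>n. c * s (k n) (g \<circ> f)) \<longlonglongrightarrow> \<Psi> (\<lambda>x. c * g x)"
      using hom[OF gf[OF g]] by (simp add: o_def)
    then show "\<Psi> (\<lambda>x. c * g x) = c * \<Psi> g"
      using LIMSEQ_unique tendsto_mult_left[OF lim[OF g]] by blast
  qed (simp add: \<Psi>_def)
  have "\<exists>P a. finite P \<and> dual_norm zN (\<lambda>g. \<Psi> g - (\<Sum>p\<in>P. a p * evalf zN p g)) < e" if "e > 0" for e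
  proof -
    have "e / 3 > 0" using \<open>e > 0\<close> by simp
    then obtain n where n: "\<forall>g\<in>lip0_ball zN. norm (free_lift zN f (s n) g - \<Psi> g) < e / 3"
      using close[of "e / 3"] by (auto simp: eventually_sequentially)
    obtain P a where P: "finite P"
      and a: "\<forall>g. g \<in> lip0_ball zN \<longrightarrow> norm (free_lift zN f (s n) g - (\<Sum>p\<in>P. a p * evalf zN p g)) \<le> e / 3"
      using free_lift_approx[OF conjunct1[OF s[rule_format, of n]] \<open>e / 3 > 0\<close>] by (elim exE conjE)
    have "dual_norm zN (\<lambda>g. \<Psi> g - (\<Sum>p\<in>P. a p * evalf zN p g)) \<le> e / 3 + e / 3"
    proof (rule dual_norm_le)
      fix g :: "'b \<Rightarrow> 'k" assume g: "g \<in> lip0_ball zN"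
      show "norm (\<Psi> g - (\<Sum>p\<in>P. a p * evalf zN p g)) \<le> e / 3 + e / 3"
        using n g a
        by (intro norm_diff_triangle_le[of _ "free_lift zN f (s n) g"]) (auto simp: norm_minus_commute less_imp_le)
    qed
    also have "\<dots> < e" using \<open>e > 0\<close> by simp
    finally show ?thesis using P by blast
  qed
  then have "\<Psi> \<in> free_space zN"
    using \<Psi>_dual by (simp add: free_space_def)
  moreover have "(\<lambda>n. dual_norm zN (\<lambda>g. free_lift zN f (s (k n)) g - \<Psi> g)) \<longlonglongrightarrow> 0"
  proof (rule tendstoI)
    fix e :: real assume "e > 0"
    have "\<forall>\<^sub>F n in sequentially. \<forall>g\<in>lip0_ball zN. norm (free_lift zN f (s (k n)) g - \<Psi> g) < e / 2"
      using close[of "e / 2"] \<open>e > 0\<close> by simp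
    then show "\<forall>\<^sub>F n in sequentially. dist (dual_norm zN (\<lambda>g. free_lift zN f (s (k n)) g - \<Psi> g)) 0 < e"
    proof (rule eventually_mono)
      fix n assume n: "\<forall>g\<in>lip0_ball zN. norm (free_lift zN f (s (k n)) g - \<Psi> g) < e / 2"
      have "dual_norm zN (\<lambda>g. free_lift zN f (s (k n)) g - \<Psi> g) \<le> e / 2"
        using n by (intro dual_norm_le) (auto intro: less_imp_le)
      moreover have "0 \<le> dual_norm zN (\<lambda>g. free_lift zN f (s (k n)) g - \<Psi> g)"
        using n by (intro dual_norm_nonneg ball_boundedI[of _ _ "e / 2"]) (simp only: less_imp_le)
      ultimately show "dist (dual_norm zN (\<lambda>g. free_lift zN f (s (k n)) g - \<Psi> g)) 0 < e"
        using \<open>e > 0\<close> by simp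
    qed
  qed
  ultimately show "\<exists>r \<Psi>. strict_mono r \<and> \<Psi> \<in> free_space zN \<and>
      (\<lambda>n. dual_norm zN (\<lambda>g. free_lift zN f (s (r n)) g - \<Psi> g)) \<longlonglongrightarrow> 0"
    using k by (intro exI[of _ k] exI[of _ \<Psi>]) simp
qed

end

lemma free_lift_compact_iff:
  fixes f :: "'a::metric_space \<Rightarrow> 'b::complete_space"
  assumes lip: "\<exists>C. C-lipschitz_on UNIV f" and base: "f zM = zN"
  shows "free_lift_compact TYPE('k::{real_normed_field,heine_borel}) zM zN f \<longleftrightarrow>
     (\<forall>S. bounded S \<longrightarrow> totally_bounded (f ` S)) \<and>
     (\<forall>\<epsilon>>0. \<exists>\<delta>>0. \<forall>x y. 0 < dist x y \<and> dist x y \<le> \<delta> \<longrightarrow>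
          dist (f x) (f y) \<le> \<epsilon> * dist x y) \<and>
     (\<forall>xs ys :: nat \<Rightarrow> 'a.
        (\<forall>n. xs n \<noteq> ys n) \<and>
        filterlim (\<lambda>n. dist (xs n) zM) at_top sequentially \<and>
        filterlim (\<lambda>n. dist (ys n) zM) at_top sequentially \<longrightarrow>
        (\<exists>p r. strict_mono r \<and> (\<lambda>n. (f (xs (r n)), f (ys (r n)))) \<longlonglongrightarrow> p) \<or>
        liminf (\<lambda>n. ereal (dist (f (xs n)) (f (ys n)) / dist (xs n) (ys n))) = 0)"
    (is "_ \<longleftrightarrow> ?P1 \<and> ?P2 \<and> ?P3")
proof
  obtain C where C: "C-lipschitz_on UNIV f" using lip by blast
  assume compact: "free_lift_compact TYPE('k) zM zN f"
  show "?P1 \<and> ?P2 \<and> ?P3"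
  proof (intro conjI allI impI)
    show "totally_bounded (f ` S)" if "bounded S" for S
      by (rule free_lift_compact_imp_totally_bounded_image[OF compact C base that])
    show "\<exists>\<delta>>0. \<forall>x y. 0 < dist x y \<and> dist x y \<le> \<delta> \<longrightarrow> dist (f x) (f y) \<le> \<epsilon> * dist x y"
      if "\<epsilon> > 0" for \<epsilon>
      by (rule free_lift_compact_imp_uniformly_locally_flat[OF compact C base that])
    fix xs ys :: "nat \<Rightarrow> 'a"
    assume "(\<forall>n. xs n \<noteq> ys n) \<and> filterlim (\<lambda>n. dist (xs n) zM) at_top sequentially \<and>
        filterlim (\<lambda>n. dist (ys n) zM) at_top sequentially"
    then show "(\<exists>p r. strict_mono r \<and> (\<lambda>n. (f (xs (r n)), f (ys (r n)))) \<longlonglongrightarrow> p) \<or>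
        liminf (\<lambda>n. ereal (dist (f (xs n)) (f (ys n)) / dist (xs n) (ys n))) = 0"
      by (intro free_lift_compact_imp_accumulation_or_flat[OF compact C base]) simp
  qed
next
  assume P: "?P1 \<and> ?P2 \<and> ?P3"
  obtain C where C: "C-lipschitz_on UNIV f" using lip by blast
  have "locally_flat_lipschitz f zM zN (C + 1)"
  proof
    show "C + 1 > 0" using lipschitz_on_nonneg[OF C] by simp
    show "dist (f x) (f y) \<le> (C + 1) * dist x y" for x y
      using lipschitz_onD[OF C, of x y] by (simp add: distrib_right add_increasing2)
  qed (use P base in \<open>simp_all\<close>)
  then show "free_lift_compact TYPE('k) zM zN f"
    by (rule locally_flat_lipschitz.free_lift_compact)
qed

theorem theoremA:
  fixes f :: "'a::complete_space \<Rightarrow> 'b::complete_space"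
    and zM :: 'a and zN :: 'b
  assumes lip: "\<exists>C. C-lipschitz_on UNIV f"
    and base: "f zM = zN"
  defines "P \<equiv>
     (\<forall>S. bounded S \<longrightarrow> totally_bounded (f ` S)) \<and>
     (\<forall>\<epsilon>>0. \<exists>\<delta>>0. \<forall>x y. 0 < dist x y \<and> dist x y \<le> \<delta> \<longrightarrow>
          dist (f x) (f y) \<le> \<epsilon> * dist x y) \<and>
     (\<forall>xs ys :: nat \<Rightarrow> 'a.
        (\<forall>n. xs n \<noteq> ys n) \<and>
        filterlim (\<lambda>n. dist (xs n) zM) at_top sequentially \<and>
        filterlim (\<lambda>n. dist (ys n) zM) at_top sequentially \<longrightarrow>
        (\<exists>p r. strict_mono r \<and> (\<lambda>n. (f (xs (r n)), f (ys (r n)))) \<longlonglongrightarrow> p) \<or>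
        liminf (\<lambda>n. ereal (dist (f (xs n)) (f (ys n)) / dist (xs n) (ys n))) = 0)"
  shows "(free_lift_compact TYPE(real) zM zN f \<longleftrightarrow> P) \<and>
         (free_lift_compact TYPE(complex) zM zN f \<longleftrightarrow> P)"
  unfolding P_def by (intro conjI free_lift_compact_iff lip base)

end
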